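(* Let $\mathcal{H}_{\mathrm{tr}}\subseteq\mathcal{H}=\mathrm{Homeo}(K)$ be the set of transitive homeomorphisms of the Cantor set $K$. Then $\mathcal{H}_{\mathrm{tr}}$, with the subspace topology, is a Polish space, and the isomorphism class of the universal odometer is generic in it, i.e. the set of $\varphi\in\mathcal{H}_{\mathrm{tr}}$ such that $(K,\varphi)$ is isomorphic to the universal odometer contains a dense $G_\delta$ subset of $\mathcal{H}_{\mathrm{tr}}$.
   Context: $K$ is the Cantor set with a fixed compatible metric $d$. $\mathcal{H}=\mathrm{Homeo}(K)$ is the space of homeomorphisms of $K$ with the complete metric $d(\varphi,\psi)=\max_{x\in K}\left(d(\varphi(x),\psi(x))+d(\varphi^{-1}(x),\psi^{-1}(x))\right)$; each $\varphi\in\mathcal{H}$ is identified with the dynamical system $(K,\varphi)$. A topological dynamical system is a pair $(X,T)$ with $X$ a nonempty compact metric space and $T$ a homeomorphism of $X$. Two systems $(X,T),(Y,S)$ are isomorphic if there is a homeomorphism $\pi:X\to Y$ with $\pi T=S\pi$. $(X,T)$ is transitive if there is $x\in X$ whose forward orbit $\{T^nx\}_{n\in\mathbb{N}}$ is dense in $X$. The universal odometer is the inverse limit, over $k\ge 1$, of the cyclic systems $(\mathbb{Z}/k!\,\mathbb{Z},\ i\mapsto i+1)$ under the reduction maps $\mathbb{Z}/(k+1)!\,\mathbb{Z}\to\mathbb{Z}/k!\,\mathbb{Z}$, with the map on the inverse limit induced by the maps $i\mapsto i+1$. *)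

theory Defs
  imports "HOL-Analysis.Analysis"
begin

section \<open>Topological dynamical systems\<close>

definition tds :: "'a topology \<Rightarrow> ('a \<Rightarrow> 'a) \<Rightarrow> bool" where
  "tds X T \<longleftrightarrow>
     topspace X \<noteq> {} \<and> compact_space X \<and> metrizable_space X \<and> homeomorphic_map X X T"

definition tds_isomorphic ::
    "'a topology \<Rightarrow> ('a \<Rightarrow> 'a) \<Rightarrow> 'b topology \<Rightarrow> ('b \<Rightarrow> 'b) \<Rightarrow> bool" where
  "tds_isomorphic X T Y S \<longleftrightarrow>
     tds X T \<and> tds Y S \<and>
     (\<exists>\<pi>. homeomorphic_map X Y \<pi> \<and> (\<forall>x \<in> topspace X. \<pi> (T x) = S (\<pi> x)))"

definition tds_transitive :: "'a topology \<Rightarrow> ('a \<Rightarrow> 'a) \<Rightarrow> bool" where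
  "tds_transitive X T \<longleftrightarrow>
     (\<exists>x \<in> topspace X. X closure_of (range (\<lambda>n::nat. (T ^^ n) x)) = topspace X)"


section \<open>The universal odometer\<close>

text \<open>
  The group of integers modulo \<open>k!\<close> is represented by its residues \<open>0, \<dots>, k! - 1\<close>. Points of the
  inverse limit are families indexed by \<open>k \<ge> 1\<close>, i.e. functions that are \<open>undefined\<close> at \<open>0\<close>.
\<close>

definition universal_odometer_space :: "(nat \<Rightarrow> nat) topology" where
  "universal_odometer_space =
     subtopology (product_topology (\<lambda>k. discrete_topology {..<fact k}) {1..})
       {x. \<forall>k\<ge>1. x (Suc k) mod fact k = x k}"

definition universal_odometer_map :: "(nat \<Rightarrow> nat) \<Rightarrow> (nat \<Rightarrow> nat)" where
  "universal_odometer_map x = (\<lambda>k\<in>{1..}. (x k + 1) mod fact k)"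


section \<open>Polish spaces and generic sets\<close>

definition Polish_space :: "'a topology \<Rightarrow> bool" where
  "Polish_space X \<longleftrightarrow> separable_space X \<and> completely_metrizable_space X"

definition generic_in :: "'a topology \<Rightarrow> 'a set \<Rightarrow> bool" where
  "generic_in X A \<longleftrightarrow> (\<exists>G. gdelta_in X G \<and> X closure_of G = topspace X \<and> G \<subseteq> A)"


section \<open>The Cantor set and its homeomorphisms\<close>

definition Cantor_topology :: "(nat \<Rightarrow> bool) topology" where
  "Cantor_topology = product_topology (\<lambda>_. discrete_topology UNIV) UNIV"

text \<open>
  A Cantor set with carrier \<open>K\<close> together with a compatible metric \<open>d\<close>: the topology of \<open>K\<close> is the
  one induced by \<open>d\<close>.
\<close>

definition Cantor_metric :: "'a set \<Rightarrow> ('a \<Rightarrow> 'a \<Rightarrow> real) \<Rightarrow> bool" where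
  "Cantor_metric K d \<longleftrightarrow>
     Metric_space K d \<and> Metric_space.mtopology K d homeomorphic_space Cantor_topology"

text \<open>
  HOL functions are total, so a self-map of \<open>K\<close> is represented by its unique representative
  that is \<open>undefined\<close> outside \<open>K\<close>.
\<close>

definition Homeo :: "'a set \<Rightarrow> ('a \<Rightarrow> 'a \<Rightarrow> real) \<Rightarrow> ('a \<Rightarrow> 'a) set" where
  "Homeo K d = {\<phi> \<in> extensional K.
     homeomorphic_map (Metric_space.mtopology K d) (Metric_space.mtopology K d) \<phi>}"

text \<open>
  For compact \<open>K\<close> the supremum is a maximum. The value \<open>0\<close> off \<open>Homeo K d\<close> is a dummy: the locale
  \<^locale>\<open>Metric_space\<close> asks for nonnegativity and symmetry on the whole type.
\<close>

definition Homeo_dist ::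
    "'a set \<Rightarrow> ('a \<Rightarrow> 'a \<Rightarrow> real) \<Rightarrow> ('a \<Rightarrow> 'a) \<Rightarrow> ('a \<Rightarrow> 'a) \<Rightarrow> real" where
  "Homeo_dist K d \<phi> \<psi> =
     (if \<phi> \<in> Homeo K d \<and> \<psi> \<in> Homeo K d
      then SUP x\<in>K. d (\<phi> x) (\<psi> x) + d (inv_into K \<phi> x) (inv_into K \<psi> x)
      else 0)"

definition Homeo_topology :: "'a set \<Rightarrow> ('a \<Rightarrow> 'a \<Rightarrow> real) \<Rightarrow> ('a \<Rightarrow> 'a) topology" where
  "Homeo_topology K d = Metric_space.mtopology (Homeo K d) (Homeo_dist K d)"

definition Homeo_tr :: "'a set \<Rightarrow> ('a \<Rightarrow> 'a \<Rightarrow> real) \<Rightarrow> ('a \<Rightarrow> 'a) set" where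
  "Homeo_tr K d = {\<phi> \<in> Homeo K d. tds_transitive (Metric_space.mtopology K d) \<phi>}"

definition Homeo_tr_topology :: "'a set \<Rightarrow> ('a \<Rightarrow> 'a \<Rightarrow> real) \<Rightarrow> ('a \<Rightarrow> 'a) topology" where
  "Homeo_tr_topology K d = subtopology (Homeo_topology K d) (Homeo_tr K d)"


section \<open>Well-definedness of the distance and of the odometer\<close>

lemma Metric_space_Homeo_dist:
  assumes "Metric_space K d" and cpt: "compact_space (Metric_space.mtopology K d)" and "K \<noteq> {}"
  shows "Metric_space (Homeo K d) (Homeo_dist K d)"
proof -
  interpret Metric_space K d by fact
  have "mbounded K"
    using cpt compactin_imp_mbounded compact_space_def topspace_mtopology by metis
  then obtain B where B: "\<And>x y. x \<in> K \<Longrightarrow> y \<in> K \<Longrightarrow> d x y \<le> B"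
    unfolding mbounded_alt by blast
  define D where "D \<phi> \<psi> x = d (\<phi> x) (\<psi> x) + d (inv_into K \<phi> x) (inv_into K \<psi> x)" for \<phi> \<psi> x
  have bij: "bij_betw \<phi> K K" if "\<phi> \<in> Homeo K d" for \<phi>
    using that by (auto simp: Homeo_def bij_betw_def homeomorphic_eq_everything_map)
  have im: "\<phi> x \<in> K" "inv_into K \<phi> x \<in> K" if "\<phi> \<in> Homeo K d" "x \<in> K" for \<phi> x
    using bij[OF that(1)] that(2) by (auto simp: bij_betw_def inv_into_into)
  have up: "D \<phi> \<psi> x \<le> (SUP x\<in>K. D \<phi> \<psi> x)"
    if "\<phi> \<in> Homeo K d" "\<psi> \<in> Homeo K d" "x \<in> K" for \<phi> \<psi> x
  proof (rule cSUP_upper[OF that(3)])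
    have "D \<phi> \<psi> y \<le> B + B" if "y \<in> K" for y
      unfolding D_def
      using B im(1)[OF \<open>\<phi> \<in> Homeo K d\<close> that] im(1)[OF \<open>\<psi> \<in> Homeo K d\<close> that]
        im(2)[OF \<open>\<phi> \<in> Homeo K d\<close> that] im(2)[OF \<open>\<psi> \<in> Homeo K d\<close> that]
      by (meson add_mono)
    then show "bdd_above (D \<phi> \<psi> ` K)"
      by (rule bdd_aboveI2)
  qed
  have HD: "Homeo_dist K d \<phi> \<psi> = (SUP x\<in>K. D \<phi> \<psi> x)"
    if "\<phi> \<in> Homeo K d" "\<psi> \<in> Homeo K d" for \<phi> \<psi>
    using that by (simp add: Homeo_dist_def D_def)
  have D0: "0 \<le> D \<phi> \<psi> x" for \<phi> \<psi> x by (simp add: D_def)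
  obtain k where k: "k \<in> K" using \<open>K \<noteq> {}\<close> by blast
  show ?thesis
  proof
    fix \<phi> \<psi>
    show "0 \<le> Homeo_dist K d \<phi> \<psi>"
    proof (cases "\<phi> \<in> Homeo K d \<and> \<psi> \<in> Homeo K d")
      case True
      then show ?thesis using HD up[of \<phi> \<psi> k] D0[of \<phi> \<psi> k] k by auto
    qed (auto simp: Homeo_dist_def)
    show "Homeo_dist K d \<phi> \<psi> = Homeo_dist K d \<psi> \<phi>"
      by (simp add: Homeo_dist_def commute conj_commute)
  next
    fix \<phi> \<psi> assume a: "\<phi> \<in> Homeo K d" "\<psi> \<in> Homeo K d"
    show "(Homeo_dist K d \<phi> \<psi> = 0) = (\<phi> = \<psi>)"
    proof
      assume "Homeo_dist K d \<phi> \<psi> = 0"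
      then have "D \<phi> \<psi> x \<le> 0" if "x \<in> K" for x
        using up[OF a that] HD[OF a] by simp
      then have "d (\<phi> x) (\<psi> x) \<le> 0" if "x \<in> K" for x
        using that nonneg[of "inv_into K \<phi> x" "inv_into K \<psi> x"]
        unfolding D_def by (smt (verit))
      then have "\<phi> x = \<psi> x" if "x \<in> K" for x
        using that im(1)[OF a(1) that] im(1)[OF a(2) that] by (simp add: order_antisym flip: zero)
      then show "\<phi> = \<psi>"
        using a by (auto simp: Homeo_def intro: extensionalityI)
    next
      assume "\<phi> = \<psi>"
      then show "Homeo_dist K d \<phi> \<psi> = 0"
        using HD[OF a] im(1)[OF a(1)] im(2)[OF a(1)] \<open>K \<noteq> {}\<close> by (simp add: D_def)
    qed
    fix \<theta> assume c: "\<theta> \<in> Homeo K d"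
    have "D \<phi> \<theta> x \<le> Homeo_dist K d \<phi> \<psi> + Homeo_dist K d \<psi> \<theta>" if "x \<in> K" for x
    proof -
      have "D \<phi> \<theta> x \<le> D \<phi> \<psi> x + D \<psi> \<theta> x"
        unfolding D_def
        using triangle[OF im(1)[OF a(1) that] im(1)[OF a(2) that] im(1)[OF c that]]
          triangle[OF im(2)[OF a(1) that] im(2)[OF a(2) that] im(2)[OF c that]]
        by linarith
      then show ?thesis
        using up[OF a that] up[OF a(2) c that] HD[OF a] HD[OF a(2) c] by linarith
    qed
    then show "Homeo_dist K d \<phi> \<theta> \<le> Homeo_dist K d \<phi> \<psi> + Homeo_dist K d \<psi> \<theta>"
      using HD[OF a(1) c] \<open>K \<noteq> {}\<close> by (simp add: cSUP_least)
  qed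
qed

lemma topspace_universal_odometer_space:
  "topspace universal_odometer_space =
     {x \<in> (\<Pi>\<^sub>E k\<in>{1..}. {..<fact k}). \<forall>k\<ge>1. x (Suc k) mod fact k = x k}"
  by (auto simp: universal_odometer_space_def topspace_product_topology)

lemma tds_universal_odometer: "tds universal_odometer_space universal_odometer_map"
proof -
  let ?P = "product_topology (\<lambda>k. discrete_topology {..<fact k::nat}) {1::nat..}"
  let ?S = "{x. \<forall>k\<ge>1. x (Suc k) mod fact k = (x k :: nat)}"
  let ?O = universal_odometer_space
  have proj: "continuous_map ?P (discrete_topology UNIV) (\<lambda>x. f (x k))"
    if "k \<ge> 1" for k and f :: "nat \<Rightarrow> nat"
    using continuous_map_compose[OF continuous_map_product_projection[of k "{1..}"
          "\<lambda>k. discrete_topology {..<fact k::nat}"], of "discrete_topology UNIV" f] that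
    by (simp add: o_def)
  have clos: "closedin ?P {x \<in> topspace ?P. x (Suc k) mod fact k = x k}" if "k \<ge> 1" for k
    using closedin_continuous_maps_eq[OF Hausdorff_space_discrete_topology
        proj[of "Suc k" "\<lambda>a. a mod fact k"] proj[of k "\<lambda>a. a"]] that by simp
  have "closedin ?P (\<Inter>k\<in>{1..}. {x \<in> topspace ?P. x (Suc k) mod fact k = x k})"
    using clos by (intro closedin_INT) auto
  moreover have "(\<Inter>k\<in>{1..}. {x \<in> topspace ?P. x (Suc k) mod fact k = x k}) = topspace ?P \<inter> ?S"
    by auto
  ultimately have "closedin ?P (topspace ?P \<inter> ?S)" by simp
  moreover have "compact_space ?P"
    by (auto simp: compact_space_product_topology compact_space_discrete_topology)
  ultimately have "compactin ?P (topspace ?P \<inter> ?S)"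
    by (rule closedin_compact_space[rotated])
  from compact_space_subtopology[OF this] have cpt: "compact_space ?O"
    by (simp only: universal_odometer_space_def subtopology_restrict)
  have "metrizable_space ?P"
    by (auto simp: metrizable_space_product_topology metrizable_space_discrete_topology
        intro: countable_subset[OF _ countableI_type])
  then have met: "metrizable_space ?O"
    unfolding universal_odometer_space_def by (rule metrizable_space_subtopology)
  have "restrict (\<lambda>_. 0) {1..} \<in> topspace ?O"
    by (auto simp: topspace_universal_odometer_space)
  then have ne: "topspace ?O \<noteq> {}" by blast
  have dv: "(fact k :: nat) dvd fact (Suc k)" for k by (simp add: fact_dvd)
  let ?g = "\<lambda>x. \<lambda>k\<in>{1..}. (x k + (fact k - 1)) mod (fact k :: nat)"
  have mem: "(\<lambda>k\<in>{1..}. h k (x k)) \<in> topspace ?O"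
    if "\<And>k. k \<ge> 1 \<Longrightarrow> h (Suc k) (x (Suc k)) mod fact k = h k (x k)"
      and "\<And>k a. h k a < fact k"
    for h :: "nat \<Rightarrow> nat \<Rightarrow> nat" and x
    using that by (auto simp: topspace_universal_odometer_space simp del: fact_Suc)
  have f1: "universal_odometer_map x \<in> topspace ?O" if "x \<in> topspace ?O" for x
  proof -
    have "((x (Suc k) + 1) mod fact (Suc k)) mod fact k = (x k + 1) mod fact k" if "k \<ge> 1" for k
    proof -
      have "x (Suc k) mod fact k = x k"
        using that \<open>x \<in> topspace ?O\<close> by (auto simp: topspace_universal_odometer_space)
      then show ?thesis using mod_add_left_eq[of "x (Suc k)" "fact k" 1] by (simp only: mod_mod_cancel[OF dv])
    qed
    then show ?thesis
      unfolding universal_odometer_map_def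
      by (intro mem[of "\<lambda>k a. (a + 1) mod fact k"]) simp_all
  qed
  have g1: "?g x \<in> topspace ?O" if "x \<in> topspace ?O" for x
  proof -
    have "((x (Suc k) + (fact (Suc k) - 1)) mod fact (Suc k)) mod fact k
        = (x k + (fact k - 1)) mod fact k" if "k \<ge> 1" for k
    proof -
      have xk: "x (Suc k) mod fact k = x k"
        using that \<open>x \<in> topspace ?O\<close> by (auto simp: topspace_universal_odometer_space)
      have "(fact (Suc k) - 1 :: nat) = (fact k - 1) + k * fact k"
        by (simp add: algebra_simps)
      then have "(fact (Suc k) - 1 :: nat) mod fact k = (fact k - 1) mod fact k"
        by (simp only: mod_mult_self1)
      then show ?thesis
        using mod_add_cong[of "x (Suc k)" "fact k" "x k"] xk
        by (simp only: mod_mod_cancel[OF dv]) (metis mod_mod_trivial)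
    qed
    then show ?thesis
      by (intro mem[of "\<lambda>k a. (a + (fact k - 1)) mod fact k"]) (simp_all del: fact_Suc)
  qed
  have cont: "continuous_map ?O ?O (\<lambda>x. \<lambda>k\<in>{1..}. h k (x k))"
    if "\<And>x. x \<in> topspace ?O \<Longrightarrow> (\<lambda>k\<in>{1..}. h k (x k)) \<in> topspace ?O"
      and "\<And>k a. h k a < fact k"
    for h :: "nat \<Rightarrow> nat \<Rightarrow> nat"
  proof -
    have "continuous_map ?O (discrete_topology {..<fact k}) (\<lambda>x. h k (x k))" if "k \<in> {1..}" for k
    proof -
      have "continuous_map ?P (discrete_topology {..<fact k}) (\<lambda>x. h k (x k))"
        using proj[of k "h k"] that \<open>\<And>k a. h k a < fact k\<close>
          continuous_map_into_subtopology[of ?P "discrete_topology UNIV" "\<lambda>x. h k (x k)" "{..<fact k}"]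
        by (auto simp: Pi_iff)
      then show ?thesis
        unfolding universal_odometer_space_def by (rule continuous_map_from_subtopology)
    qed
    then have "continuous_map ?O ?P (\<lambda>x. \<lambda>k\<in>{1..}. h k (x k))"
      by (auto simp: continuous_map_componentwise)
    then show ?thesis
      using that(1) unfolding universal_odometer_space_def
      by (intro continuous_map_into_subtopology) auto
  qed
  have cf: "continuous_map ?O ?O universal_odometer_map"
    using cont[of "\<lambda>k a. (a + 1) mod fact k"] f1
    by (simp add: universal_odometer_map_def [abs_def])
  have cg: "continuous_map ?O ?O ?g"
    using cont[of "\<lambda>k a. (a + (fact k - 1)) mod fact k"] g1 by simp
  have pt: "((a + 1) mod m + (m - 1)) mod m = a" "((a + (m - 1)) mod m + 1) mod m = a"
    if "a < m" for a m :: nat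
  proof -
    have "a + 1 + (m - 1) = a + m" "a + (m - 1) + 1 = a + m" using that by auto
    then show "((a + 1) mod m + (m - 1)) mod m = a" "((a + (m - 1)) mod m + 1) mod m = a"
      using that by (simp_all only: mod_add_left_eq mod_add_self2 mod_less)
  qed
  have gf: "?g (universal_odometer_map x) = x" "universal_odometer_map (?g x) = x"
    if "x \<in> topspace ?O" for x
  proof -
    have x: "x \<in> extensional {1..}" "\<And>k. k \<ge> 1 \<Longrightarrow> x k < fact k"
      using that by (auto simp: topspace_universal_odometer_space PiE_def Pi_iff)
    show "?g (universal_odometer_map x) = x"
      by (rule extensionalityI[OF _ x(1)])
        (simp_all only: universal_odometer_map_def restrict_apply' atLeast_iff pt(1) x(2)
          restrict_extensional)
    show "universal_odometer_map (?g x) = x"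
      unfolding universal_odometer_map_def
      by (rule extensionalityI[OF _ x(1)])
        (simp_all only: restrict_apply' atLeast_iff pt(2) x(2) restrict_extensional)
  qed
  have "homeomorphic_maps ?O ?O universal_odometer_map ?g"
    unfolding homeomorphic_maps_def using cf cg gf by blast
  then have "homeomorphic_map ?O ?O universal_odometer_map"
    using homeomorphic_map_maps by blast
  then show ?thesis using ne cpt met by (simp add: tds_def)
qed

end

theory Submission
  imports Defs
begin

text \<open>
  Fix a homeomorphism of \<open>K\<close> with the space of binary sequences and let \<open>bits n x\<close> be the first
  \<open>n\<close> bits of \<open>x\<close>. By compactness, "close in \<open>d\<close>" and "equal first \<open>n\<close> bits" are uniformly the same
  thing, so every topological notion below is expressed by finite words: a map into a discrete set is
  continuous iff it depends on finitely many bits, and a basis at \<open>f\<close> of the topology of the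
  homeomorphism group consists of the sets of \<open>g\<close> such that \<open>g\<close> agrees with \<open>f\<close>, and the inverse of
  \<open>g\<close> with that of \<open>f\<close>, in the first \<open>n\<close> bits everywhere (\<open>near n f g\<close>).

  Polishness. The group is complete, because a Cauchy sequence converges bit by bit together with its
  inverses, and each of its subspaces is separable, because up to \<open>near n\<close> a homeomorphism is
  determined by a finite table. A homeomorphism is transitive iff every cylinder is moved to meet
  every other one by some forward iterate: necessity uses that \<open>K\<close> has no isolated points,
  sufficiency is Baire's theorem on \<open>K\<close>. Each instance of this condition is open, so the transitive
  homeomorphisms form a \<open>G\<^sub>\<delta>\<close>.

  Genericity. Let \<open>adding_machines\<close> be the set of homeomorphisms \<open>f\<close> that have, for every \<open>n\<close>, a
  continuous map \<open>c\<close> to \<open>\<int>/m\<close>, with \<open>n!\<close> dividing \<open>m\<close>, which turns \<open>f\<close> into \<open>+1\<close> and determines the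
  first \<open>n\<close> bits. If one \<open>c\<close> works for \<open>f\<close>, then it works for all \<open>g\<close> close to \<open>f\<close>, so this is a
  \<open>G\<^sub>\<delta>\<close>. All orbits of such an \<open>f\<close> are dense. Normalise the maps \<open>c\<close> to vanish at a common point: on
  its orbit all of them are then reductions of the time, hence they are compatible everywhere, and
  reducing them modulo \<open>k!\<close> gives the coordinates of an isomorphism onto the universal odometer
  (\<open>adding_machine_isomorphic_odometer\<close>).

  Density (\<open>ex_adding_machine_near\<close>) remains. Let \<open>f\<close> be transitive, with a dense orbit
  \<open>x\<^sub>0, x\<^sub>1, \<dots>\<close>, and let \<open>r\<close> be a continuous map with finitely many values that records the first
  \<open>n\<close> bits of \<open>x\<close>, of \<open>f x\<close> and of the preimage of \<open>x\<close>. Since the dense orbit recurs, there is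
  \<open>m > 0\<close> with \<open>r x\<^sub>m = r x\<^sub>0\<close> such that all values of \<open>r\<close> occur among \<open>r x\<^sub>0, \<dots>, r x\<^sub>m\<^sub>-\<^sub>1\<close>. The
  fibres of \<open>r\<close> can be cut into nonempty clopen pieces indexed by the times at which the orbit visits
  them (\<open>ex_coding\<close>); this is a partition of \<open>K\<close> into \<open>m\<close> pieces, and any homeomorphism that
  permutes the pieces cyclically does to the values of \<open>r\<close> what \<open>f\<close> does. Such a
  homeomorphism can be chosen to be an adding machine: the partition is refined infinitely often,
  splitting the pieces of each stage into equally many parts, until points are separated and every
  \<open>k!\<close> divides some number of pieces. This identifies \<open>K\<close> with the universal odometer in such a way
  that each piece is a residue class, and \<open>+1\<close> is pulled back (\<open>ex_adding_machine_over_coding\<close>).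
\<close>

section \<open>A Cantor set in binary coordinates\<close>

text \<open>
  The last assumption says that \<open>e\<close> is a homeomorphism onto the space of binary sequences: the
  cylinders are a basis of the topology of \<open>K\<close>.
\<close>

locale Cantor_bits = Metric_space K d for K :: "'a set" and d +
  fixes e :: "'a \<Rightarrow> nat \<Rightarrow> bool"
  assumes bij_e: "bij_betw e K UNIV"
    and compact: "compact_space mtopology"
    and openin_coords: "openin mtopology U \<longleftrightarrow>
      U \<subseteq> K \<and> (\<forall>x\<in>U. \<exists>n. \<forall>y\<in>K. (\<forall>i<n. e y i = e x i) \<longrightarrow> y \<in> U)"
begin

definition bits :: "nat \<Rightarrow> 'a \<Rightarrow> bool list" where
  "bits n x = map (e x) [0..<n]"

text \<open>
  By compactness this is continuity into a discrete space (\<open>loc_const_iff\<close>); the number of bits is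
  bounded uniformly on \<open>K\<close>.
\<close>

definition loc_const :: "('a \<Rightarrow> 'b) \<Rightarrow> bool" where
  "loc_const c \<longleftrightarrow> (\<exists>n. \<forall>x\<in>K. \<forall>y\<in>K. bits n x = bits n y \<longrightarrow> c x = c y)"

definition bits_continuous :: "('a \<Rightarrow> 'a) \<Rightarrow> bool" where
  "bits_continuous f \<longleftrightarrow> f \<in> K \<rightarrow> K \<and> (\<forall>n. loc_const (\<lambda>x. bits n (f x)))"

lemma bits_eq_iff: "bits n x = bits n y \<longleftrightarrow> (\<forall>i<n. e x i = e y i)"
  by (auto simp: bits_def)

lemma bits_mono: "bits n x = bits n y \<Longrightarrow> m \<le> n \<Longrightarrow> bits m x = bits m y"
  by (simp add: bits_eq_iff)

lemma bits_SucD: "bits (Suc n) x = bits (Suc n) y \<Longrightarrow> bits n x = bits n y"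
  by (rule bits_mono) auto

lemma bits_separate_points: "x = y" if "x \<in> K" "y \<in> K" "\<And>n. bits n x = bits n y"
proof -
  have "e x i = e y i" for i
    using that(3)[of "Suc i"] unfolding bits_eq_iff by blast
  then have "e x = e y" by blast
  then show ?thesis
    using bij_e that(1,2) by (auto simp: bij_betw_def inj_on_def)
qed

lemma ex_point: obtains x where "x \<in> K" "e x = w"
  using bij_e by (metis UNIV_I bij_betw_def imageE)

lemma K_nonempty: "K \<noteq> {}"
  using ex_point by blast

lemma openin_iff_cylinders:
  "openin mtopology U \<longleftrightarrow> U \<subseteq> K \<and> (\<forall>x\<in>U. \<exists>n. \<forall>y\<in>K. bits n y = bits n x \<longrightarrow> y \<in> U)"
  unfolding bits_eq_iff by (rule openin_coords)

lemma finite_bits: "finite (bits n ` K)"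
proof -
  have "bits n ` K \<subseteq> {l. set l \<subseteq> UNIV \<and> length l = n}"
    by (auto simp: bits_def)
  then show ?thesis
    using finite_lists_length_eq[of "UNIV :: bool set" n] finite_subset by auto
qed

lemma loc_constE:
  assumes "loc_const c"
  obtains n where "\<And>x y. x \<in> K \<Longrightarrow> y \<in> K \<Longrightarrow> bits n x = bits n y \<Longrightarrow> c x = c y"
  using assms unfolding loc_const_def by blast

lemma loc_constI:
  "(\<And>x y. x \<in> K \<Longrightarrow> y \<in> K \<Longrightarrow> bits n x = bits n y \<Longrightarrow> c x = c y) \<Longrightarrow> loc_const c"
  unfolding loc_const_def by blast

lemma loc_const_finite:
  assumes "loc_const c"
  shows "finite (c ` K)"
proof -
  obtain n where n: "\<And>x y. x \<in> K \<Longrightarrow> y \<in> K \<Longrightarrow> bits n x = bits n y \<Longrightarrow> c x = c y"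
    using assms by (rule loc_constE) blast
  have "c x = c (SOME y. y \<in> K \<and> bits n y = bits n x)" if "x \<in> K" for x
    using someI[of "\<lambda>y. y \<in> K \<and> bits n y = bits n x" x] that n by metis
  then have "c ` K \<subseteq> (\<lambda>w. c (SOME y. y \<in> K \<and> bits n y = w)) ` (bits n ` K)"
    by blast
  then show ?thesis
    using finite_bits finite_surj by blast
qed

lemma loc_const_bits: "loc_const (bits n)"
  unfolding loc_const_def by blast

lemma loc_const_comp: "loc_const c \<Longrightarrow> loc_const (\<lambda>x. f (c x))"
  unfolding loc_const_def by metis

lemma loc_const_Pair:
  assumes "loc_const c" "loc_const c'"
  shows "loc_const (\<lambda>x. (c x, c' x))"
proof -
  obtain n where n: "\<And>x y. x \<in> K \<Longrightarrow> y \<in> K \<Longrightarrow> bits n x = bits n y \<Longrightarrow> c x = c y"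
    using assms(1) by (rule loc_constE) blast 
  obtain n' where n': "\<And>x y. x \<in> K \<Longrightarrow> y \<in> K \<Longrightarrow> bits n' x = bits n' y \<Longrightarrow> c' x = c' y"
    using assms(2) by (rule loc_constE) blast
  show ?thesis
  proof (rule loc_constI)
    fix x y assume xy: "x \<in> K" "y \<in> K" and eq: "bits (max n n') x = bits (max n n') y"
    show "(c x, c' x) = (c y, c' y)"
      using n[OF xy bits_mono[OF eq]] n'[OF xy bits_mono[OF eq]] by simp
  qed
qed

lemma loc_const_compose:
  assumes "loc_const c" "bits_continuous f"
  shows "loc_const (\<lambda>x. c (f x))"
proof -
  obtain n where n: "\<And>x y. x \<in> K \<Longrightarrow> y \<in> K \<Longrightarrow> bits n x = bits n y \<Longrightarrow> c x = c y"
    using assms(1) by (rule loc_constE) blast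
  have f: "f \<in> K \<rightarrow> K" and "loc_const (\<lambda>x. bits n (f x))"
    using assms(2) unfolding bits_continuous_def by blast+
  from this(2) obtain k
    where k: "\<And>x y. x \<in> K \<Longrightarrow> y \<in> K \<Longrightarrow> bits k x = bits k y \<Longrightarrow> bits n (f x) = bits n (f y)"
    by (rule loc_constE) blast
  show ?thesis
  proof (rule loc_constI[of k])
    fix x y assume xy: "x \<in> K" "y \<in> K" "bits k x = bits k y"
    show "c (f x) = c (f y)"
      using n[OF _ _ k[OF xy]] f xy(1,2) by blast
  qed
qed

text \<open>
  The form in which compactness is used throughout: a property of points that only depends on the first
  \<open>n\<close> bits, and that gets easier with \<open>n\<close>, holds for one common \<open>n\<close> if it holds at each point for
  some \<open>n\<close>. Otherwise the points at which stage \<open>n\<close> fails form a decreasing sequence of nonempty closed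
  sets.
\<close>

lemma prefix_compactness:
  assumes dep: "\<And>n x y. x \<in> K \<Longrightarrow> y \<in> K \<Longrightarrow> bits n x = bits n y \<Longrightarrow> Q n x \<Longrightarrow> Q n y"
    and mono: "\<And>n x. x \<in> K \<Longrightarrow> Q n x \<Longrightarrow> Q (Suc n) x"
    and ex: "\<And>x. x \<in> K \<Longrightarrow> \<exists>n. Q n x"
  shows "\<exists>n. \<forall>x\<in>K. Q n x"
proof (rule ccontr)
  assume contra: "\<not> (\<exists>n. \<forall>x\<in>K. Q n x)"
  define C where "C n = {x \<in> K. \<not> Q n x}" for n
  have "closedin mtopology (C n)" for n
  proof -
    have "topspace mtopology - C n = {x \<in> K. Q n x}"
      by (auto simp: C_def)
    moreover have "openin mtopology {x \<in> K. Q n x}"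
      unfolding openin_iff_cylinders using dep[of _ _ n] by (metis (mono_tags, lifting) mem_Collect_eq subsetI)
    ultimately show ?thesis
      by (auto simp: closedin_def C_def)
  qed
  moreover have "C n \<noteq> {}" for n using contra by (auto simp: C_def)
  moreover have "decseq C"
    using mono by (intro decseq_SucI) (auto simp: C_def)
  ultimately have "(\<Inter>n. C n) \<noteq> {}"
    using compact_space_imp_nest[OF compact] by blast
  then show False using ex by (auto simp: C_def)
qed

lemma loc_const_iff: "loc_const c \<longleftrightarrow> continuous_map mtopology (discrete_topology UNIV) c"
proof
  assume "loc_const c"
  then show "continuous_map mtopology (discrete_topology UNIV) c"
  proof -
    obtain n where n: "\<And>x y. x \<in> K \<Longrightarrow> y \<in> K \<Longrightarrow> bits n x = bits n y \<Longrightarrow> c x = c y"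
      using \<open>loc_const c\<close> by (rule loc_constE) blast
    have "openin mtopology {x \<in> K. c x \<in> U}" for U
      unfolding openin_iff_cylinders
    proof (intro conjI ballI exI[of _ n] impI)
      fix x y assume "x \<in> {x \<in> K. c x \<in> U}" "y \<in> K" "bits n y = bits n x"
      then show "y \<in> {x \<in> K. c x \<in> U}" using n[of y x] by simp
    qed auto
    then show ?thesis by (simp add: continuous_map_def)
  qed
next
  assume c: "continuous_map mtopology (discrete_topology UNIV) c"
  let ?Q = "\<lambda>n x. \<forall>y\<in>K. \<forall>z\<in>K. bits n y = bits n x \<longrightarrow> bits n z = bits n x \<longrightarrow> c y = c z"
  have "\<exists>n. \<forall>x\<in>K. ?Q n x"
  proof (rule prefix_compactness[where Q = ?Q])
    fix n x y assume eq: "bits n x = bits n y" and "?Q n x"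
    from this(2) show "?Q n y" unfolding eq .
  next
    fix n x assume "x \<in> K" "?Q n x"
    then show "?Q (Suc n) x" using bits_SucD[of n _ x] by blast
  next
    fix x assume x: "x \<in> K"
    have "openin mtopology {y \<in> K. c y \<in> {c x}}"
      using openin_continuous_map_preimage[OF c, of "{c x}"] by simp
    then obtain n where "\<forall>y\<in>K. bits n y = bits n x \<longrightarrow> c y = c x"
      unfolding openin_iff_cylinders using x by auto
    then have "?Q n x" by (metis (no_types))
    then show "\<exists>n. ?Q n x" by blast
  qed
  then obtain n where "\<forall>x\<in>K. ?Q n x" by blast
  then show "loc_const c" by (intro loc_constI[of n]) blast
qed

text \<open>
  This lemma and the next compare \<open>d\<close> with the bits uniformly; afterwards the metric is only met through
  them.
\<close>

lemma prefixes_refine_metric: "\<exists>n. \<forall>x\<in>K. \<forall>y\<in>K. bits n x = bits n y \<longrightarrow> d x y < r" if "r > 0"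
proof -
  let ?Q = "\<lambda>n x. \<forall>y\<in>K. \<forall>z\<in>K. bits n y = bits n x \<longrightarrow> bits n z = bits n x \<longrightarrow> d y z < r"
  have "\<exists>n. \<forall>x\<in>K. ?Q n x"
  proof (rule prefix_compactness[where Q = ?Q])
    fix n x y assume eq: "bits n x = bits n y" and "?Q n x"
    from this(2) show "?Q n y" unfolding eq .
  next
    fix n x assume "x \<in> K" "?Q n x"
    then show "?Q (Suc n) x" using bits_SucD[of n _ x] by blast
  next
    fix x assume x: "x \<in> K"
    have "openin mtopology (mball x (r/2))" "x \<in> mball x (r/2)" using x that by simp_all
    then obtain n where n: "\<forall>y\<in>K. bits n y = bits n x \<longrightarrow> y \<in> mball x (r/2)"
      unfolding openin_iff_cylinders by blast
    have "d y z < r" if "y \<in> K" "z \<in> K" "bits n y = bits n x" "bits n z = bits n x" for y z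
      using n that triangle'[of y x z] triangle[of y x z] commute[of x y] x
      by (smt (verit) field_sum_of_halves in_mball)
    then show "\<exists>n. ?Q n x" by blast
  qed
  then obtain n where "\<forall>x\<in>K. ?Q n x" by blast
  then show ?thesis by (intro exI[of _ n]) blast
qed

lemma metric_refines_prefixes:
  "\<exists>r>0. \<forall>x\<in>K. \<forall>y\<in>K. d x y < r \<longrightarrow> bits n x = bits n y"
proof -
  let ?Q = "\<lambda>k x. \<forall>y\<in>K. \<forall>z\<in>K. bits k y = bits k x \<longrightarrow> d y z < 1 / (real k + 1) \<longrightarrow> bits n y = bits n z"
  have "\<exists>k. \<forall>x\<in>K. ?Q k x"
  proof (rule prefix_compactness[where Q = ?Q])
    fix k x y assume eq: "bits k x = bits k y" and "?Q k x"
    from this(2) show "?Q k y" unfolding eq .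
  next
    fix k x assume Q: "x \<in> K" "?Q k x"
    have "1 / (real (Suc k) + 1) \<le> 1 / (real k + 1)" by (simp add: frac_le)
    then have less: "r < 1 / (real k + 1)" if "r < 1 / (real (Suc k) + 1)" for r
      using that by linarith
    show "?Q (Suc k) x"
    proof (intro ballI impI)
      fix y z assume "y \<in> K" "z \<in> K" "bits (Suc k) y = bits (Suc k) x"
        "d y z < 1 / (real (Suc k) + 1)"
      then show "bits n y = bits n z"
        using Q(2)[rule_format, of y z] bits_SucD less by blast
    qed
  next
    fix x assume x: "x \<in> K"
    have "openin mtopology {y \<in> K. bits n y = bits n x}"
      unfolding openin_iff_cylinders by (intro conjI ballI exI[of _ n]) auto
    moreover have "x \<in> {y \<in> K. bits n y = bits n x}" using x by simp
    ultimately obtain r where "r > 0" and "mball x r \<subseteq> {y \<in> K. bits n y = bits n x}"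
      unfolding openin_mtopology by blast
    then have r: "r > 0" "\<And>y. y \<in> K \<Longrightarrow> d x y < r \<Longrightarrow> bits n y = bits n x"
      using x by auto
    obtain k where k: "\<forall>x\<in>K. \<forall>y\<in>K. bits k x = bits k y \<longrightarrow> d x y < r/2"
      using prefixes_refine_metric[of "r/2"] r by auto
    obtain l :: nat where l: "1 / (real l + 1) < r/2"
      using reals_Archimedean[of "r/2"] r by (auto simp: inverse_eq_divide add.commute)
    define j where "j = max k l"
    have j: "1 / (real j + 1) < r/2"
    proof -
      have "1 / (real j + 1) \<le> 1 / (real l + 1)" by (simp add: j_def frac_le)
      with l show ?thesis by linarith
    qed
    have "bits n y = bits n z"
      if "y \<in> K" "z \<in> K" "bits j y = bits j x" "d y z < 1 / (real j + 1)" for y z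
    proof -
      have "d x y < r/2" using k bits_mono[OF that(3), of k] that x by (auto simp: j_def)
      moreover have "d x z \<le> d x y + d y z" using triangle x that by blast
      ultimately have "d x y < r" "d x z < r" using that j r by linarith+
      then show ?thesis using r(2)[of y] r(2)[of z] that by simp
    qed
    then show "\<exists>k. ?Q k x" by blast
  qed
  then obtain k where k: "\<forall>x\<in>K. ?Q k x" by blast
  have "bits n x = bits n y" if "x \<in> K" "y \<in> K" "d x y < 1 / (real k + 1)" for x y
    using k[rule_format, of x x y] that by simp
  moreover have "1 / (real k + 1) > 0" by simp
  ultimately show ?thesis by blast
qed

lemma bits_continuous_iff: "bits_continuous f \<longleftrightarrow> continuous_map mtopology mtopology f"
proof
  assume f: "bits_continuous f"
  then have fK: "f \<in> K \<rightarrow> K" and f: "loc_const (\<lambda>x. bits n (f x))" for n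
    unfolding bits_continuous_def by blast+
  have "openin mtopology {x \<in> K. f x \<in> U}" if U: "openin mtopology U" for U
    unfolding openin_iff_cylinders
  proof (intro conjI ballI)
    fix x assume "x \<in> {x \<in> K. f x \<in> U}"
    then have x: "x \<in> K" "f x \<in> U" by auto
    obtain n where n: "\<forall>y\<in>K. bits n y = bits n (f x) \<longrightarrow> y \<in> U"
      using U x(2) unfolding openin_iff_cylinders by blast
    obtain k where k: "\<And>x y. x \<in> K \<Longrightarrow> y \<in> K \<Longrightarrow> bits k x = bits k y \<Longrightarrow> bits n (f x) = bits n (f y)"
      using f[of n] by (rule loc_constE) blast
    have "f y \<in> U" if "y \<in> K" "bits k y = bits k x" for y
      using n fK k[OF that(1) x(1) that(2)] that(1) by blast
    then show "\<exists>k. \<forall>y\<in>K. bits k y = bits k x \<longrightarrow> y \<in> {x \<in> K. f x \<in> U}"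
      by blast
  qed auto
  moreover note fK
  ultimately show "continuous_map mtopology mtopology f"
    by (simp add: continuous_map_def)
next
  assume f: "continuous_map mtopology mtopology f"
  have "continuous_map mtopology (discrete_topology UNIV) (bits n)" for n
    using loc_const_bits loc_const_iff by blast
  then have "loc_const (\<lambda>x. bits n (f x))" for n
    using continuous_map_compose[OF f] unfolding loc_const_iff o_def by blast
  then show "bits_continuous f"
    using f unfolding bits_continuous_def continuous_map_def by auto
qed

end

lemma openin_Cantor_topology:
  "openin Cantor_topology V \<longleftrightarrow> (\<forall>w\<in>V. \<exists>n. \<forall>v. (\<forall>i<n. v i = w i) \<longrightarrow> v \<in> V)"
proof
  assume V: "openin Cantor_topology V"
  show "\<forall>w\<in>V. \<exists>n. \<forall>v. (\<forall>i<n. v i = w i) \<longrightarrow> v \<in> V"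
  proof
    fix w assume "w \<in> V"
    then obtain B where B: "finite {i. B i \<noteq> UNIV}" "w \<in> Pi\<^sub>E UNIV B" "Pi\<^sub>E UNIV B \<subseteq> V"
      using V unfolding Cantor_topology_def openin_product_topology_alt by auto
    obtain n where n: "\<And>i. B i \<noteq> UNIV \<Longrightarrow> i < n"
      using B(1) unfolding finite_nat_set_iff_bounded by auto
    have "v \<in> V" if "\<forall>i<n. v i = w i" for v
    proof -
      have "v i \<in> B i" for i
      proof (cases "B i = UNIV")
        case False
        then show ?thesis using n[OF False] that PiE_mem[OF B(2), of i] by simp
      qed simp
      then show ?thesis using B(3) by blast
    qed
    then show "\<exists>n. \<forall>v. (\<forall>i<n. v i = w i) \<longrightarrow> v \<in> V" by blast
  qed
next
  assume V: "\<forall>w\<in>V. \<exists>n. \<forall>v. (\<forall>i<n. v i = w i) \<longrightarrow> v \<in> V"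
  show "openin Cantor_topology V"
    unfolding Cantor_topology_def openin_product_topology_alt
  proof (intro conjI ballI)
    fix w assume "w \<in> V"
    then obtain n where n: "\<And>v. (\<forall>i<n. v i = w i) \<Longrightarrow> v \<in> V" using V by metis
    let ?B = "\<lambda>i. if i < n then {w i} else UNIV"
    have "{i. ?B i \<noteq> UNIV} \<subseteq> {..<n}" by auto
    then have "finite {i. ?B i \<noteq> UNIV}" using finite_subset by blast
    moreover have "w \<in> Pi\<^sub>E UNIV ?B" by auto
    moreover have "Pi\<^sub>E UNIV ?B \<subseteq> V"
    proof
      fix v assume v: "v \<in> Pi\<^sub>E UNIV ?B"
      have "v i = w i" if "i < n" for i using PiE_mem[OF v, of i] that by simp
      then show "v \<in> V" using n by blast
    qed
    ultimately show "\<exists>U. finite {i \<in> UNIV. U i \<noteq> topspace (discrete_topology UNIV)} \<and>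
        (\<forall>i\<in>UNIV. openin (discrete_topology UNIV) (U i)) \<and> w \<in> Pi\<^sub>E UNIV U \<and> Pi\<^sub>E UNIV U \<subseteq> V"
      by (intro exI[of _ ?B]) auto
  qed
qed

lemma Cantor_metric_bits:
  assumes "Cantor_metric K d"
  obtains e where "Cantor_bits K d e"
proof -
  interpret Metric_space K d using assms by (simp add: Cantor_metric_def)
  have hs: "mtopology homeomorphic_space Cantor_topology"
    using assms by (simp add: Cantor_metric_def)
  then obtain e where e: "homeomorphic_map mtopology Cantor_topology e"
    unfolding homeomorphic_space by blast
  have top: "topspace Cantor_topology = UNIV" by (simp add: Cantor_topology_def)
  have bij: "bij_betw e K UNIV"
    using e top unfolding homeomorphic_eq_everything_map bij_betw_def by auto
  have "compact_space Cantor_topology"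
    unfolding Cantor_topology_def compact_space_product_topology
    by (simp add: compact_space_discrete_topology)
  then have "compact_space mtopology"
    using hs homeomorphic_compact_space by blast
  moreover have "openin mtopology U \<longleftrightarrow>
      U \<subseteq> K \<and> (\<forall>x\<in>U. \<exists>n. \<forall>y\<in>K. (\<forall>i<n. e y i = e x i) \<longrightarrow> y \<in> U)" for U
  proof (cases "U \<subseteq> K")
    case True
    have "openin mtopology U \<longleftrightarrow> openin Cantor_topology (e ` U)"
      using homeomorphic_map_openness[OF e, of U] True by simp
    also have "\<dots> \<longleftrightarrow> (\<forall>x\<in>U. \<exists>n. \<forall>v. (\<forall>i<n. v i = e x i) \<longrightarrow> v \<in> e ` U)"
      unfolding openin_Cantor_topology by auto
    also have "\<dots> \<longleftrightarrow> (\<forall>x\<in>U. \<exists>n. \<forall>y\<in>K. (\<forall>i<n. e y i = e x i) \<longrightarrow> y \<in> U)"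
    proof -
      have "(\<forall>v. (\<forall>i<n. v i = e x i) \<longrightarrow> v \<in> e ` U)
          \<longleftrightarrow> (\<forall>y\<in>K. (\<forall>i<n. e y i = e x i) \<longrightarrow> y \<in> U)" for x n
      proof -
        have "(\<forall>v. (\<forall>i<n. v i = e x i) \<longrightarrow> v \<in> e ` U)
          \<longleftrightarrow> (\<forall>v\<in>e ` K. (\<forall>i<n. v i = e x i) \<longrightarrow> v \<in> e ` U)"
          using bij by (simp add: bij_betw_def)
        also have "\<dots> \<longleftrightarrow> (\<forall>y\<in>K. (\<forall>i<n. e y i = e x i) \<longrightarrow> e y \<in> e ` U)" by blast
        also have "\<dots> \<longleftrightarrow> (\<forall>y\<in>K. (\<forall>i<n. e y i = e x i) \<longrightarrow> y \<in> U)"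
          using bij True by (meson bij_betw_def inj_on_image_mem_iff)
        finally show ?thesis .
      qed
      then show ?thesis by simp
    qed
    finally show ?thesis using True by simp
  next
    case False
    then have "\<not> openin mtopology U" using openin_subset[of mtopology U] by auto
    with False show ?thesis by blast
  qed
  ultimately have "Cantor_bits_axioms K d e"
    unfolding Cantor_bits_axioms_def using bij by blast
  with Metric_space_axioms have "Cantor_bits K d e"
    by (rule Cantor_bits.intro)
  then show ?thesis by (rule that)
qed

section \<open>The space of homeomorphisms\<close>

context Cantor_bits
begin

abbreviation Homeos :: "('a \<Rightarrow> 'a) set" where
  "Homeos \<equiv> Homeo K d"

definition near :: "nat \<Rightarrow> ('a \<Rightarrow> 'a) \<Rightarrow> ('a \<Rightarrow> 'a) \<Rightarrow> bool" where
  "near n f g \<longleftrightarrow> (\<forall>x\<in>K. bits n (f x) = bits n (g x) \<and>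
     bits n (inv_into K f x) = bits n (inv_into K g x))"

lemma near_mono: "near n f g \<Longrightarrow> m \<le> n \<Longrightarrow> near m f g"
  unfolding near_def using bits_mono by blast

lemma HomeoI:
  assumes "f \<in> extensional K" "bits_continuous f" "bits_continuous g"
    and gf: "\<And>x. x \<in> K \<Longrightarrow> g (f x) = x" and fg: "\<And>x. x \<in> K \<Longrightarrow> f (g x) = x"
  shows "f \<in> Homeos" and "\<And>x. x \<in> K \<Longrightarrow> inv_into K f x = g x"
proof -
  have "homeomorphic_maps mtopology mtopology f g"
    using assms by (simp add: homeomorphic_maps_def bits_continuous_iff)
  then show "f \<in> Homeos"
    using assms(1) by (auto simp: Homeo_def homeomorphic_map_maps)
  fix x assume x: "x \<in> K"
  have "inj_on f K" using gf by (rule inj_on_inverseI)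
  moreover have "g x \<in> K" using x assms(3) by (auto simp: bits_continuous_def)
  ultimately have "inv_into K f (f (g x)) = g x" by (rule inv_into_f_f)
  then show "inv_into K f x = g x" by (simp only: fg[OF x])
qed

lemma HomeoD:
  assumes "f \<in> Homeos"
  shows "f \<in> extensional K" "bits_continuous f" "bits_continuous (inv_into K f)"
    "\<And>x. x \<in> K \<Longrightarrow> f x \<in> K" "\<And>x. x \<in> K \<Longrightarrow> inv_into K f x \<in> K"
    "\<And>x. x \<in> K \<Longrightarrow> inv_into K f (f x) = x" "\<And>x. x \<in> K \<Longrightarrow> f (inv_into K f x) = x"
proof -
  have hom: "homeomorphic_map mtopology mtopology f" and "f \<in> extensional K"
    using assms by (auto simp: Homeo_def)
  then show "f \<in> extensional K" by blast
  have bij: "inj_on f K" "f ` K = K" and "continuous_map mtopology mtopology f"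
    using hom by (auto simp: homeomorphic_eq_everything_map)
  then show "bits_continuous f" by (simp add: bits_continuous_iff)
  show left: "inv_into K f (f x) = x" if "x \<in> K" for x
    using bij that by simp
  show right: "f (inv_into K f x) = x" if "x \<in> K" for x
    using bij that by (simp add: f_inv_into_f)
  show im: "f x \<in> K" "inv_into K f x \<in> K" if "x \<in> K" for x
    using bij that by (auto simp: inv_into_into)
  obtain g where g: "homeomorphic_maps mtopology mtopology f g"
    using hom unfolding homeomorphic_map_maps by blast
  then have "continuous_map mtopology mtopology g" by (simp add: homeomorphic_maps_def)
  moreover have "g x = inv_into K f x" if "x \<in> topspace mtopology" for x
  proof -
    have "g (f (inv_into K f x)) = inv_into K f x"
      using g im(2)[of x] that by (simp add: homeomorphic_maps_def)
    then show ?thesis using right[of x] that by simp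
  qed
  ultimately have "continuous_map mtopology mtopology (inv_into K f)"
    by (rule continuous_map_eq)
  then show "bits_continuous (inv_into K f)" by (simp add: bits_continuous_iff)
qed

lemma Metric_space_Homeos: "Metric_space Homeos (Homeo_dist K d)"
  using Metric_space_Homeo_dist[OF Metric_space_axioms compact K_nonempty] .

text \<open>
  Together with the next lemma: the relations \<open>near n\<close> and the distance define the same uniformity.
  The factor \<open>1/3\<close> in the proof leaves room for the two summands of the distance and for the
  strictness that is lost in the supremum.
\<close>

lemma near_imp_dist_less: "\<exists>n. \<forall>f\<in>Homeos. \<forall>g\<in>Homeos. near n f g \<longrightarrow> Homeo_dist K d f g < r" if "r > 0"
proof -
  have "r / 3 > 0" using that by simp
  then obtain n where n: "\<forall>x\<in>K. \<forall>y\<in>K. bits n x = bits n y \<longrightarrow> d x y < r / 3"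
    using prefixes_refine_metric by blast
  have "Homeo_dist K d f g < r" if f: "f \<in> Homeos" and g: "g \<in> Homeos" and near: "near n f g" for f g
  proof -
    have "d (f x) (g x) + d (inv_into K f x) (inv_into K g x) \<le> r / 3 + r / 3" if "x \<in> K" for x
    proof (rule add_mono)
      show "d (f x) (g x) \<le> r / 3"
        using n HomeoD(4)[OF f that] HomeoD(4)[OF g that] near that unfolding near_def
        by (intro less_imp_le) blast
      show "d (inv_into K f x) (inv_into K g x) \<le> r / 3"
        using n HomeoD(5)[OF f that] HomeoD(5)[OF g that] near that unfolding near_def
        by (intro less_imp_le) blast
    qed
    then have "(SUP x\<in>K. d (f x) (g x) + d (inv_into K f x) (inv_into K g x)) \<le> r / 3 + r / 3"
      by (rule cSUP_least[OF K_nonempty])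
    then have "Homeo_dist K d f g \<le> r / 3 + r / 3"
      using f g by (simp only: Homeo_dist_def simp_thms if_True)
    with \<open>r > 0\<close> show ?thesis by linarith
  qed
  then show ?thesis by blast
qed

lemma dist_less_imp_near:
  "\<exists>r>0. \<forall>f\<in>Homeos. \<forall>g\<in>Homeos. Homeo_dist K d f g < r \<longrightarrow> near n f g"
proof -
  obtain r where r: "r > 0" "\<forall>x\<in>K. \<forall>y\<in>K. d x y < r \<longrightarrow> bits n x = bits n y"
    using metric_refines_prefixes by blast
  have "mbounded K"
    using compact compactin_imp_mbounded compact_space_def topspace_mtopology by metis
  then obtain C where C: "\<And>x y. x \<in> K \<Longrightarrow> y \<in> K \<Longrightarrow> d x y \<le> C"
    unfolding mbounded_alt by blast
  have "near n f g" if f: "f \<in> Homeos" and g: "g \<in> Homeos" and less: "Homeo_dist K d f g < r" for f g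
    unfolding near_def
  proof
    fix x assume x: "x \<in> K"
    let ?D = "\<lambda>x. d (f x) (g x) + d (inv_into K f x) (inv_into K g x)"
    have "?D y \<le> C + C" if "y \<in> K" for y
      by (rule add_mono[OF C[OF HomeoD(4)[OF f that] HomeoD(4)[OF g that]]
            C[OF HomeoD(5)[OF f that] HomeoD(5)[OF g that]]])
    then have "bdd_above (?D ` K)" by (rule bdd_aboveI2)
    then have "?D x \<le> (SUP x\<in>K. ?D x)" by (rule cSUP_upper[OF x])
    also have "\<dots> < r" using less f g by (simp add: Homeo_dist_def)
    finally have "d (f x) (g x) < r" "d (inv_into K f x) (inv_into K g x) < r"
      using nonneg[of "f x" "g x"] nonneg[of "inv_into K f x" "inv_into K g x"] by linarith+
    then show "bits n (f x) = bits n (g x) \<and> bits n (inv_into K f x) = bits n (inv_into K g x)"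
      using r(2) HomeoD(4,5)[OF f x] HomeoD(4,5)[OF g x] by blast
  qed
  with r(1) show ?thesis by blast
qed

lemma topspace_Homeo: "topspace (Homeo_topology K d) = Homeos"
  using Metric_space.topspace_mtopology[OF Metric_space_Homeos] by (simp add: Homeo_topology_def)

lemma openin_Homeo:
  "openin (Homeo_topology K d) U \<longleftrightarrow>
     U \<subseteq> Homeos \<and> (\<forall>f\<in>U. \<exists>n. \<forall>g\<in>Homeos. near n f g \<longrightarrow> g \<in> U)"
proof -
  interpret H: Metric_space Homeos "Homeo_dist K d" by (rule Metric_space_Homeos)
  have "(\<exists>r>0. H.mball f r \<subseteq> U) \<longleftrightarrow> (\<exists>n. \<forall>g\<in>Homeos. near n f g \<longrightarrow> g \<in> U)"
    if f: "f \<in> Homeos" for f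
  proof
    assume "\<exists>r>0. H.mball f r \<subseteq> U"
    then obtain r where r: "r > 0" "H.mball f r \<subseteq> U" by blast
    obtain n where "\<forall>f\<in>Homeos. \<forall>g\<in>Homeos. near n f g \<longrightarrow> Homeo_dist K d f g < r"
      using near_imp_dist_less[OF r(1)] by blast
    then have "\<forall>g\<in>Homeos. near n f g \<longrightarrow> g \<in> U"
      using f r(2) H.in_mball by blast
    then show "\<exists>n. \<forall>g\<in>Homeos. near n f g \<longrightarrow> g \<in> U" ..
  next
    assume "\<exists>n. \<forall>g\<in>Homeos. near n f g \<longrightarrow> g \<in> U"
    then obtain n where n: "\<forall>g\<in>Homeos. near n f g \<longrightarrow> g \<in> U" ..
    obtain r where "r > 0" "\<forall>f\<in>Homeos. \<forall>g\<in>Homeos. Homeo_dist K d f g < r \<longrightarrow> near n f g"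
      using dist_less_imp_near by blast
    then show "\<exists>r>0. H.mball f r \<subseteq> U"
      using n f H.in_mball by (intro exI[of _ r]) blast
  qed
  then show ?thesis
    unfolding Homeo_topology_def H.openin_mtopology by blast
qed

subsection \<open>Completeness\<close>

text \<open>
  \<open>N\<close> is a modulus of convergence. The limit takes its \<open>i\<close>-th bit from a term by which the first
  \<open>i + 1\<close> bits have stabilised.
\<close>

lemma prefix_limit:
  fixes u :: "nat \<Rightarrow> 'a" and N :: "nat \<Rightarrow> nat"
  assumes u: "\<And>i. u i \<in> K"
    and N: "\<And>n i j. N n \<le> i \<Longrightarrow> N n \<le> j \<Longrightarrow> bits n (u i) = bits n (u j)"
  obtains y where "y \<in> K" "\<And>n i. N n \<le> i \<Longrightarrow> bits n (u i) = bits n y"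
proof -
  obtain y where y: "y \<in> K" "e y = (\<lambda>i. e (u (N (Suc i))) i)"
    by (rule ex_point)
  have "bits n (u i) = bits n y" if "N n \<le> i" for n i
    unfolding bits_eq_iff
  proof (intro allI impI)
    fix k assume k: "k < n"
    let ?j = "max i (N (Suc k))"
    have "bits n (u i) = bits n (u ?j)" using that by (intro N) auto
    moreover have "bits (Suc k) (u ?j) = bits (Suc k) (u (N (Suc k)))" by (intro N) auto
    ultimately have "e (u i) k = e (u (N (Suc k))) k"
      using k unfolding bits_eq_iff by simp
    then show "e (u i) k = e y k" by (simp add: y(2))
  qed
  with y(1) show ?thesis by (rule that)
qed

text \<open>
  Being inverse to each other survives in the limit because \<open>F\<close> is continuous: \<open>F (G x)\<close> is close to
  \<open>F (g i x)\<close>, which is close to \<open>f i (g i x) = x\<close>.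
\<close>

lemma limits_of_inverses:
  fixes f g :: "nat \<Rightarrow> 'a \<Rightarrow> 'a" and N :: "nat \<Rightarrow> nat"
  assumes fg: "\<And>i x. x \<in> K \<Longrightarrow> f i (g i x) = x"
    and gK: "\<And>i x. x \<in> K \<Longrightarrow> g i x \<in> K"
    and F: "\<And>x. x \<in> K \<Longrightarrow> F x \<in> K" "\<And>n i x. x \<in> K \<Longrightarrow> N n \<le> i \<Longrightarrow> bits n (f i x) = bits n (F x)"
    and G: "\<And>x. x \<in> K \<Longrightarrow> G x \<in> K" "\<And>n i x. x \<in> K \<Longrightarrow> N n \<le> i \<Longrightarrow> bits n (g i x) = bits n (G x)"
    and cont: "bits_continuous F" and x: "x \<in> K"
  shows "F (G x) = x"
proof (rule bits_separate_points)
  show "F (G x) \<in> K" "x \<in> K" using F G x by blast+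
  fix n
  have "loc_const (\<lambda>x. bits n (F x))" using cont unfolding bits_continuous_def by blast
  then obtain k
    where k: "\<And>x y. x \<in> K \<Longrightarrow> y \<in> K \<Longrightarrow> bits k x = bits k y \<Longrightarrow> bits n (F x) = bits n (F y)"
    by (rule loc_constE) blast
  let ?i = "max (N n) (N k)"
  have "bits n (F (G x)) = bits n (F (g ?i x))"
    by (rule k[symmetric]) (use x in \<open>auto intro!: gK G\<close>)
  also have "\<dots> = bits n (f ?i (g ?i x))"
    by (rule F(2)[symmetric]) (use x in \<open>auto intro!: gK\<close>)
  also have "\<dots> = bits n x" by (simp only: fg[OF x])
  finally show "bits n (F (G x)) = bits n x" .
qed

lemma bits_continuous_uniform_limit:
  fixes f :: "nat \<Rightarrow> 'a \<Rightarrow> 'a" and N :: "nat \<Rightarrow> nat"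
  assumes f: "\<And>i. bits_continuous (f i)"
    and F: "\<And>x. x \<in> K \<Longrightarrow> F x \<in> K" "\<And>n i x. x \<in> K \<Longrightarrow> N n \<le> i \<Longrightarrow> bits n (f i x) = bits n (F x)"
  shows "bits_continuous F"
proof -
  have "loc_const (\<lambda>x. bits n (F x))" for n
  proof -
    have "loc_const (\<lambda>x. bits n (f (N n) x))" using f unfolding bits_continuous_def by blast
    then obtain k where k: "\<And>x y. x \<in> K \<Longrightarrow> y \<in> K \<Longrightarrow> bits k x = bits k y \<Longrightarrow>
        bits n (f (N n) x) = bits n (f (N n) y)"
      by (rule loc_constE) blast
    show ?thesis
    proof (rule loc_constI[of k])
      fix x y assume xy: "x \<in> K" "y \<in> K" "bits k x = bits k y"
      show "bits n (F x) = bits n (F y)"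
        using k[OF xy] F(2)[OF xy(1), of n "N n"] F(2)[OF xy(2), of n "N n"] by (simp only: order_refl)
    qed
  qed
  then show ?thesis using F(1) unfolding bits_continuous_def by blast
qed

lemma completely_metrizable_Homeo: "completely_metrizable_space (Homeo_topology K d)"
proof -
  interpret H: Metric_space Homeos "Homeo_dist K d" by (rule Metric_space_Homeos)
  have "\<exists>F. limitin H.mtopology s F sequentially" if cauchy: "H.MCauchy s" for s
  proof -
    have sH: "s i \<in> Homeos" for i using cauchy unfolding H.MCauchy_def by blast
    have "\<exists>N. \<forall>i\<ge>N. \<forall>j\<ge>N. near n (s i) (s j)" for n
    proof -
      obtain r where r: "r > 0" "\<forall>f\<in>Homeos. \<forall>g\<in>Homeos. Homeo_dist K d f g < r \<longrightarrow> near n f g"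
        using dist_less_imp_near by blast
      then obtain N where "\<forall>i j. N \<le> i \<longrightarrow> N \<le> j \<longrightarrow> Homeo_dist K d (s i) (s j) < r"
        using cauchy unfolding H.MCauchy_def by blast
      then show ?thesis using r(2) sH by blast
    qed
    then obtain N where N: "\<And>n i j. N n \<le> i \<Longrightarrow> N n \<le> j \<Longrightarrow> near n (s i) (s j)" by metis
    let ?g = "\<lambda>i. inv_into K (s i)"
    have "\<exists>y. y \<in> K \<and> (\<forall>n. \<forall>i\<ge>N n. bits n (s i x) = bits n y)" if x: "x \<in> K" for x
    proof -
      obtain y where "y \<in> K" "\<And>n i. N n \<le> i \<Longrightarrow> bits n (s i x) = bits n y"
      proof (rule prefix_limit[of "\<lambda>i. s i x" N])
        show "s i x \<in> K" for i using HomeoD(4)[OF sH x] .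
        show "bits n (s i x) = bits n (s j x)" if "N n \<le> i" "N n \<le> j" for n i j
          using N[OF that] x unfolding near_def by blast
      qed blast
      then show ?thesis by blast
    qed
    then obtain F where F: "\<And>x. x \<in> K \<Longrightarrow> F x \<in> K"
      "\<And>n i x. x \<in> K \<Longrightarrow> N n \<le> i \<Longrightarrow> bits n (s i x) = bits n (F x)" by metis
    have "\<exists>y. y \<in> K \<and> (\<forall>n. \<forall>i\<ge>N n. bits n (?g i x) = bits n y)" if x: "x \<in> K" for x
    proof -
      obtain y where "y \<in> K" "\<And>n i. N n \<le> i \<Longrightarrow> bits n (?g i x) = bits n y"
      proof (rule prefix_limit[of "\<lambda>i. ?g i x" N])
        show "?g i x \<in> K" for i using HomeoD(5)[OF sH x] .
        show "bits n (?g i x) = bits n (?g j x)" if "N n \<le> i" "N n \<le> j" for n i j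
          using N[OF that] x unfolding near_def by blast
      qed blast
      then show ?thesis by blast
    qed
    then obtain G where G: "\<And>x. x \<in> K \<Longrightarrow> G x \<in> K"
      "\<And>n i x. x \<in> K \<Longrightarrow> N n \<le> i \<Longrightarrow> bits n (?g i x) = bits n (G x)" by metis
    define F' where "F' = restrict F K"
    have F': "\<And>x. x \<in> K \<Longrightarrow> F' x \<in> K"
      "\<And>n i x. x \<in> K \<Longrightarrow> N n \<le> i \<Longrightarrow> bits n (s i x) = bits n (F' x)"
      using F by (simp_all only: F'_def restrict_apply')
    have contF: "bits_continuous F'"
      by (rule bits_continuous_uniform_limit[OF HomeoD(2)[OF sH] F'])
    have contG: "bits_continuous G"
      by (rule bits_continuous_uniform_limit[OF HomeoD(3)[OF sH] G])
    have FG: "F' (G x) = x" if "x \<in> K" for x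
      by (rule limits_of_inverses[OF HomeoD(7)[OF sH] HomeoD(5)[OF sH] F' G contF that])
    have GF: "G (F' x) = x" if "x \<in> K" for x
      by (rule limits_of_inverses[OF HomeoD(6)[OF sH] HomeoD(4)[OF sH] G F' contG that])
    have ext: "F' \<in> extensional K" by (simp add: F'_def)
    note F'_Homeo = HomeoI(1)[OF ext contF contG GF FG] and inv_F' = HomeoI(2)[OF ext contF contG GF FG]
    have near: "near n F' (s i)" if "N n \<le> i" for n i
      unfolding near_def using F'(2)[OF _ that] G(2)[OF _ that] inv_F' by simp
    have "limitin H.mtopology s F' sequentially"
      unfolding limitin_def eventually_sequentially
    proof (intro conjI allI impI)
      show "F' \<in> topspace H.mtopology" using F'_Homeo by simp
      fix U assume "openin H.mtopology U \<and> F' \<in> U"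
      then obtain n where "\<forall>g\<in>Homeos. near n F' g \<longrightarrow> g \<in> U"
        using openin_Homeo unfolding Homeo_topology_def by blast
      then show "\<exists>N. \<forall>i\<ge>N. s i \<in> U" using near sH by blast
    qed
    then show ?thesis by blast
  qed
  then have H.mcomplete unfolding H.mcomplete_def by blast
  then show ?thesis
    unfolding Homeo_topology_def by (rule H.completely_metrizable_space_mtopology)
qed

subsection \<open>Separability\<close>

text \<open>
  A locally constant map is coded by a number of bits that determine it and the table of its values on
  words of that length, so there are only countably many of them.
\<close>

lemma loc_const_keys:
  obtains key :: "('a \<Rightarrow> bool list) \<Rightarrow> nat \<times> bool list list"
  where "\<And>c c' x. loc_const c \<Longrightarrow> loc_const c' \<Longrightarrow> key c = key c' \<Longrightarrow> x \<in> K \<Longrightarrow> c x = c' x"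
proof -
  define depth where "depth c = (SOME n. \<forall>x\<in>K. \<forall>y\<in>K. bits n x = bits n y \<longrightarrow> c x = c y)"
    for c :: "'a \<Rightarrow> bool list"
  define point where "point w = inv_into K e (\<lambda>i. i < length w \<and> w ! i)" for w
  define key where "key c = (depth c, map (\<lambda>w. c (point w)) (List.n_lists (depth c) [True, False]))" for c
  have "c x = c' x" if c: "loc_const c" "loc_const c'" and key: "key c = key c'" and x: "x \<in> K" for c c' x
  proof -
    have depth: "c x = c y" if "loc_const c" "x \<in> K" "y \<in> K" "bits (depth c) x = bits (depth c) y"
      for c x y
      using someI_ex[OF \<open>loc_const c\<close>[unfolded loc_const_def], folded depth_def] that by blast
    define n where "n = depth c"
    have n: "depth c = n" "depth c' = n" using key by (simp_all add: key_def n_def)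
    let ?w = "bits n x"
    have "?w \<in> set (List.n_lists n [True, False])"
      by (auto simp: set_n_lists bits_def)
    then have eq: "c (point ?w) = c' (point ?w)"
      using key by (simp add: key_def n)
    have surj: "e ` K = UNIV" using bij_e by (simp add: bij_betw_def)
    then have p: "point ?w \<in> K" "e (point ?w) = (\<lambda>i. i < length ?w \<and> ?w ! i)"
      unfolding point_def by (simp_all add: inv_into_into f_inv_into_f)
    have "bits n x = bits n (point ?w)"
      unfolding bits_eq_iff using p(2) by (simp add: bits_def)
    then show ?thesis
      using depth[OF c(1) x p(1)] depth[OF c(2) x p(1)] eq unfolding n by metis
  qed
  then show ?thesis by (rule that)
qed

lemma separable_subtopology_Homeo:
  assumes S: "S \<subseteq> Homeos"
  shows "separable_space (subtopology (Homeo_topology K d) S)"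
proof -
  obtain key :: "('a \<Rightarrow> bool list) \<Rightarrow> nat \<times> bool list list" where
    key: "\<And>c c' x. loc_const c \<Longrightarrow> loc_const c' \<Longrightarrow> key c = key c' \<Longrightarrow> x \<in> K \<Longrightarrow> c x = c' x"
    by (rule loc_const_keys) blast
  define keys where "keys n f = (key (\<lambda>x. bits n (f x)), key (\<lambda>x. bits n (inv_into K f x)))" for n f
  have keys: "near n f g" if "f \<in> S" "g \<in> S" "keys n f = keys n g" for n f g
  proof -
    have "f \<in> Homeos" "g \<in> Homeos" using that S by blast+
    note lc = HomeoD(2,3)[OF this(1)] HomeoD(2,3)[OF this(2)]
    show ?thesis
      unfolding near_def
      using key[of "\<lambda>x. bits n (f x)" "\<lambda>x. bits n (g x)"]
        key[of "\<lambda>x. bits n (inv_into K f x)" "\<lambda>x. bits n (inv_into K g x)"] lc that(3)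
      unfolding bits_continuous_def keys_def by blast
  qed
  define D where "D = (\<Union>n. inv_into S (keys n) ` keys n ` S)"
  have "countable (keys n ` S)" for n by (rule countableI_type)
  then have "countable D" unfolding D_def by blast
  moreover have DS: "D \<subseteq> S" unfolding D_def by (auto simp: inv_into_into)
  moreover have "f \<in> subtopology (Homeo_topology K d) S closure_of D" if f: "f \<in> S" for f
    unfolding in_closure_of
  proof (intro conjI allI impI)
    show "f \<in> topspace (subtopology (Homeo_topology K d) S)"
      using f S by (simp add: topspace_Homeo subset_iff)
    fix T assume "f \<in> T \<and> openin (subtopology (Homeo_topology K d) S) T"
    then obtain U where U: "openin (Homeo_topology K d) U" "T = U \<inter> S" "f \<in> U"
      unfolding openin_subtopology by blast
    then obtain n where n: "\<forall>g\<in>Homeos. near n f g \<longrightarrow> g \<in> U"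
      unfolding openin_Homeo by blast
    let ?g = "inv_into S (keys n) (keys n f)"
    have g: "?g \<in> S" "keys n ?g = keys n f"
      using f by (auto simp: inv_into_into f_inv_into_f)
    then have "near n f ?g" using keys[OF f g(1)] by simp
    then have "?g \<in> T" using n g(1) S U(2) by blast
    moreover have "?g \<in> D" using f unfolding D_def by blast
    ultimately show "\<exists>y. y \<in> D \<and> y \<in> T" by blast
  qed
  then have "subtopology (Homeo_topology K d) S closure_of D
      = topspace (subtopology (Homeo_topology K d) S)"
    using closure_of_subset_topspace[of "subtopology (Homeo_topology K d) S" D]
    by (auto simp: topspace_Homeo)
  ultimately show ?thesis
    unfolding separable_space_def using S by (auto simp: topspace_Homeo)
qed

section \<open>Transitive homeomorphisms form a Polish space\<close>

definition dense_orbit :: "('a \<Rightarrow> 'a) \<Rightarrow> 'a \<Rightarrow> bool" where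
  "dense_orbit f x \<longleftrightarrow> (\<forall>y\<in>K. \<forall>n. \<exists>i. bits n ((f ^^ i) x) = bits n y)"

lemma closure_of_iff_cylinders:
  assumes "S \<subseteq> K"
  shows "mtopology closure_of S = {y \<in> K. \<forall>n. \<exists>z\<in>S. bits n z = bits n y}"
proof (intro equalityI subsetI)
  fix y assume y: "y \<in> mtopology closure_of S"
  have "\<exists>z\<in>S. bits n z = bits n y" for n
  proof -
    have "openin mtopology {z \<in> K. bits n z = bits n y}"
      unfolding openin_iff_cylinders by (intro conjI ballI exI[of _ n]) auto
    moreover have "y \<in> {z \<in> K. bits n z = bits n y}"
      using y by (simp add: in_closure_of)
    moreover have "\<forall>T. y \<in> T \<and> openin mtopology T \<longrightarrow> (\<exists>z. z \<in> S \<and> z \<in> T)"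
      using y unfolding in_closure_of by blast
    ultimately have "\<exists>z. z \<in> S \<and> z \<in> {z \<in> K. bits n z = bits n y}" by (meson spec mp conjI)
    then show ?thesis by blast
  qed
  with y show "y \<in> {y \<in> K. \<forall>n. \<exists>z\<in>S. bits n z = bits n y}"
    by (simp add: in_closure_of)
next
  fix y assume y: "y \<in> {y \<in> K. \<forall>n. \<exists>z\<in>S. bits n z = bits n y}"
  show "y \<in> mtopology closure_of S"
    unfolding in_closure_of
  proof (intro conjI allI impI)
    show "y \<in> topspace mtopology" using y by simp
    fix T assume T: "y \<in> T \<and> openin mtopology T"
    then obtain n where n: "\<forall>z\<in>K. bits n z = bits n y \<longrightarrow> z \<in> T"
      unfolding openin_iff_cylinders by blast
    obtain z where "z \<in> S" "bits n z = bits n y" using y by blast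
    with n assms show "\<exists>z. z \<in> S \<and> z \<in> T" by blast
  qed
qed

lemma funpow_in_K: "f \<in> Homeos \<Longrightarrow> x \<in> K \<Longrightarrow> (f ^^ i) x \<in> K"
  by (induction i) (simp_all add: HomeoD(4))

lemma bits_continuous_funpow: "bits_continuous (f ^^ i)" if f: "f \<in> Homeos"
proof -
  have "loc_const (\<lambda>x. bits n ((f ^^ i) x))" for n
  proof (induction i)
    case 0
    show ?case using loc_const_bits by simp
  next
    case (Suc i)
    show ?case
      using loc_const_compose[OF Suc HomeoD(2)[OF f]] by (simp add: funpow_swap1)
  qed
  then show ?thesis
    unfolding bits_continuous_def using funpow_in_K[OF f] by blast
qed

lemma tds_transitive_iff:
  assumes f: "f \<in> Homeos"
  shows "tds_transitive mtopology f \<longleftrightarrow> (\<exists>x\<in>K. dense_orbit f x)"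
proof -
  have "mtopology closure_of range (\<lambda>i. (f ^^ i) x) = K \<longleftrightarrow> dense_orbit f x" if x: "x \<in> K" for x
  proof -
    have "range (\<lambda>i. (f ^^ i) x) \<subseteq> K" using funpow_in_K[OF f x] by blast
    then have "mtopology closure_of range (\<lambda>i. (f ^^ i) x)
        = {y \<in> K. \<forall>n. \<exists>i. bits n ((f ^^ i) x) = bits n y}"
      using closure_of_iff_cylinders by simp
    then show ?thesis unfolding dense_orbit_def by blast
  qed
  then show ?thesis unfolding tds_transitive_def by simp
qed

text \<open>
  Since \<open>K\<close> has no isolated points, a dense orbit visits each cylinder at arbitrarily late times.
\<close>

lemma dense_orbit_recurs:
  assumes orbit: "dense_orbit f x" and y: "y \<in> K"
  shows "\<exists>i\<ge>N. bits n ((f ^^ i) x) = bits n y"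
proof -
  \<comment> \<open>A diagonal argument: \<open>z\<close> lies in the cylinder of \<open>y\<close> and, for each \<open>i < N\<close>, differs from the
    \<open>i\<close>-th orbit point in bit \<open>n + i\<close>.\<close>
  obtain z where z: "z \<in> K"
    "e z = (\<lambda>j. if j < n then e y j else \<not> e ((f ^^ (j - n)) x) j)"
    by (rule ex_point)
  obtain i where i: "bits (n + N) ((f ^^ i) x) = bits (n + N) z"
    using orbit z(1) unfolding dense_orbit_def by blast
  have "i \<ge> N"
  proof (rule ccontr)
    assume "\<not> i \<ge> N"
    then have "e ((f ^^ i) x) (n + i) = e z (n + i)"
      using i unfolding bits_eq_iff by simp
    then show False by (simp add: z(2))
  qed
  moreover have "bits n z = bits n y"
    unfolding bits_eq_iff by (simp add: z(2))
  moreover have "bits n ((f ^^ i) x) = bits n z" using bits_mono[OF i] by simp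
  ultimately show ?thesis by metis
qed

text \<open>
  Required for all words, this is topological transitivity: some iterate of the cylinder of
  \<open>u\<close> meets the cylinder of \<open>v\<close>. As a condition on \<open>f\<close> it is open.
\<close>

definition meets :: "bool list \<Rightarrow> bool list \<Rightarrow> ('a \<Rightarrow> 'a) \<Rightarrow> bool" where
  "meets u v f \<longleftrightarrow> (\<exists>i. \<exists>x\<in>K. bits (length u) x = u \<and> bits (length v) ((f ^^ i) x) = v)"

lemma ex_cylinder_point: "\<exists>x\<in>K. bits (length u) x = u"
proof -
  obtain x where x: "x \<in> K" "e x = (\<lambda>i. u ! i)" by (rule ex_point)
  have "bits (length u) x = u" by (simp add: bits_def x(2) map_nth)
  with x(1) show ?thesis by blast
qed

text \<open>
  For necessity, follow the dense orbit from a visit to the first cylinder to a later visit to the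
  second one. For sufficiency, the points whose forward orbit visits a given cylinder form a dense open
  set, and there are countably many cylinders.
\<close>

lemma transitive_iff_meets:
  assumes f: "f \<in> Homeos"
  shows "(\<exists>x\<in>K. dense_orbit f x) \<longleftrightarrow> (\<forall>u v. meets u v f)"
proof
  assume "\<exists>x\<in>K. dense_orbit f x"
  then obtain x where x: "x \<in> K" "dense_orbit f x" by blast
  show "\<forall>u v. meets u v f"
  proof (intro allI)
    fix u v
    obtain y z where y: "y \<in> K" "bits (length u) y = u" and z: "z \<in> K" "bits (length v) z = v"
      using ex_cylinder_point by metis
    obtain i where i: "bits (length u) ((f ^^ i) x) = u"
      using x(2) y unfolding dense_orbit_def by metis
    obtain j where j: "j \<ge> i" "bits (length v) ((f ^^ j) x) = v"
      using dense_orbit_recurs[OF x(2) z(1)] z(2) by metis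
    have "(f ^^ (j - i)) ((f ^^ i) x) = (f ^^ j) x"
      using j(1) by (simp flip: funpow_add comp_apply[of "f ^^ (j - i)" "f ^^ i"])
    with j(2) i show "meets u v f"
      unfolding meets_def using funpow_in_K[OF f x(1)] by metis
  qed
next
  assume meets: "\<forall>u v. meets u v f"
  define V where "V v = {x \<in> K. \<exists>i. bits (length v) ((f ^^ i) x) = v}" for v
  have "openin mtopology (V v)" for v
    unfolding openin_iff_cylinders
  proof (intro conjI ballI)
    fix x assume "x \<in> V v"
    then obtain i where i: "x \<in> K" "bits (length v) ((f ^^ i) x) = v" unfolding V_def by blast
    have "loc_const (\<lambda>x. bits (length v) ((f ^^ i) x))"
      using bits_continuous_funpow[OF f] unfolding bits_continuous_def by blast
    then obtain k where k: "\<And>x y. x \<in> K \<Longrightarrow> y \<in> K \<Longrightarrow> bits k x = bits k y \<Longrightarrow>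
        bits (length v) ((f ^^ i) x) = bits (length v) ((f ^^ i) y)"
      by (rule loc_constE) blast
    have "y \<in> V v" if "y \<in> K" "bits k y = bits k x" for y
    proof -
      have "bits (length v) ((f ^^ i) y) = v"
        using k[OF that(1) i(1) that(2)] i(2) by (rule trans)
      then show ?thesis unfolding V_def using that(1) by blast
    qed
    then show "\<exists>n. \<forall>y\<in>K. bits n y = bits n x \<longrightarrow> y \<in> V v" by blast
  qed (auto simp: V_def)
  moreover have "mtopology closure_of (V v) = K" for v
  proof -
    have "V v \<subseteq> K" by (auto simp: V_def)
    moreover have "\<exists>z\<in>V v. bits n z = bits n y" if "y \<in> K" for n y
    proof -
      obtain i z where z: "z \<in> K" "bits (length (bits n y)) z = bits n y"
          "bits (length v) ((f ^^ i) z) = v"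
        using meets unfolding meets_def by blast
      have "length (bits n y) = n" by (simp add: bits_def)
      then have "bits n z = bits n y" using z(2) by (simp only:)
      moreover have "z \<in> V v" unfolding V_def using z(1,3) by blast
      ultimately show ?thesis by blast
    qed
    ultimately show ?thesis using closure_of_iff_cylinders[of "V v"] by blast
  qed
  moreover have "countable (range V)" by blast
  ultimately have "mtopology closure_of \<Inter>(range V) = K"
    using compact_space_imp_mcomplete[OF compact]
    by (intro metric_Baire_category) auto
  then have "\<Inter>(range V) \<noteq> {}" using K_nonempty by force
  then obtain x where x: "\<And>v. x \<in> V v" by blast
  have "\<exists>i. bits n ((f ^^ i) x) = bits n y" for n y
  proof -
    have "length (bits n y) = n" by (simp add: bits_def)
    moreover obtain i where "bits (length (bits n y)) ((f ^^ i) x) = bits n y"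
      using x[of "bits n y"] unfolding V_def by blast
    ultimately show ?thesis by metis
  qed
  then show "\<exists>x\<in>K. dense_orbit f x"
    using x unfolding dense_orbit_def V_def by blast
qed

text \<open>
  Iteration is continuous in the homeomorphism, uniformly on \<open>K\<close>.
\<close>

lemma near_funpow:
  assumes f: "f \<in> Homeos"
  shows "\<exists>n. \<forall>g\<in>Homeos. near n f g \<longrightarrow> (\<forall>x\<in>K. bits k ((g ^^ i) x) = bits k ((f ^^ i) x))"
proof (induction i arbitrary: k)
  case 0
  show ?case by simp
next
  case (Suc i)
  have "loc_const (\<lambda>x. bits k (f x))" using HomeoD(2)[OF f] unfolding bits_continuous_def by blast
  then obtain l where l: "\<And>x y. x \<in> K \<Longrightarrow> y \<in> K \<Longrightarrow> bits l x = bits l y \<Longrightarrow> bits k (f x) = bits k (f y)"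
    by (rule loc_constE) blast
  obtain n where n: "\<And>g x. g \<in> Homeos \<Longrightarrow> near n f g \<Longrightarrow> x \<in> K \<Longrightarrow> bits l ((g ^^ i) x) = bits l ((f ^^ i) x)"
    using Suc[of l] by blast
  have "bits k ((g ^^ Suc i) x) = bits k ((f ^^ Suc i) x)"
    if g: "g \<in> Homeos" and near: "near (max k n) f g" and x: "x \<in> K" for g x
  proof -
    have "near k f g" "near n f g" using near_mono[OF near] by simp_all
    have "bits k (g ((g ^^ i) x)) = bits k (f ((g ^^ i) x))"
      using \<open>near k f g\<close> funpow_in_K[OF g x] unfolding near_def by metis
    also have "\<dots> = bits k (f ((f ^^ i) x))"
      by (rule l[OF funpow_in_K[OF g x] funpow_in_K[OF f x] n[OF g \<open>near n f g\<close> x]])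
    finally show ?thesis by simp
  qed
  then show ?case by blast
qed

lemma openin_meets: "openin (Homeo_topology K d) {f \<in> Homeos. meets u v f}"
  unfolding openin_Homeo
proof (intro conjI ballI)
  fix f assume "f \<in> {f \<in> Homeos. meets u v f}"
  then obtain i x where f: "f \<in> Homeos" and ix: "x \<in> K" "bits (length u) x = u"
    "bits (length v) ((f ^^ i) x) = v" unfolding meets_def by blast
  obtain n where "\<forall>g\<in>Homeos. near n f g \<longrightarrow>
      (\<forall>x\<in>K. bits (length v) ((g ^^ i) x) = bits (length v) ((f ^^ i) x))"
    using near_funpow[OF f] by blast
  then have "\<forall>g\<in>Homeos. near n f g \<longrightarrow> meets u v g"
    using ix unfolding meets_def by metis
  then show "\<exists>n. \<forall>g\<in>Homeos. near n f g \<longrightarrow> g \<in> {f \<in> Homeos. meets u v f}" by blast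
qed auto

lemma gdelta_Homeo_tr: "gdelta_in (Homeo_topology K d) (Homeo_tr K d)"
proof -
  have "Homeo_tr K d = (\<Inter>(u, v). {f \<in> Homeos. meets u v f})"
    unfolding Homeo_tr_def using tds_transitive_iff transitive_iff_meets by auto
  moreover have "gdelta_in (Homeo_topology K d) (\<Inter>(u, v). {f \<in> Homeos. meets u v f})"
    using openin_meets by (intro gdelta_in_Inter open_imp_gdelta_in) (auto intro: countableI_type)
  ultimately show ?thesis by simp
qed

lemma Polish_Homeo_tr: "Polish_space (Homeo_tr_topology K d)"
proof -
  have "Homeo_tr K d \<subseteq> Homeos" by (auto simp: Homeo_tr_def)
  then show ?thesis
    unfolding Polish_space_def Homeo_tr_topology_def
    using separable_subtopology_Homeo
      completely_metrizable_space_gdelta_in[OF completely_metrizable_Homeo gdelta_Homeo_tr]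
    by blast
qed

section \<open>Codings by finite cycles\<close>

text \<open>
  The combinatorial core: the fibres of \<open>r\<close> can be cut into nonempty clopen pieces with any
  prescribed nonempty finite index sets, since they contain no isolated points. The index sets are the fibres of
  \<open>s\<close>. Concretely, if \<open>r\<close> depends on the first \<open>n\<close> bits, then the number \<open>j x\<close> of bits equal to
  \<open>True\<close> among the next \<open>M - 1\<close> takes every value below \<open>M\<close> on every fibre; use \<open>j x\<close> as the index if
  it belongs to the fibre of \<open>x\<close>, and some fixed index of that fibre otherwise.
\<close>

lemma ex_coding:
  fixes r :: "'a \<Rightarrow> 'b" and s :: "nat \<Rightarrow> 'b"
  assumes r: "loc_const r" and s: "s ` {..<M} = r ` K"
  obtains p where "loc_const p" "p ` K = {..<M}" "\<And>x. x \<in> K \<Longrightarrow> s (p x) = r x"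
proof -
  obtain n where n: "\<And>x y. x \<in> K \<Longrightarrow> y \<in> K \<Longrightarrow> bits n x = bits n y \<Longrightarrow> r x = r y"
    using r by (rule loc_constE) blast
  have M: "M > 0" using s K_nonempty by (cases M) auto
  define j where "j x = card {i. i < M - 1 \<and> e x (n + i)}" for x
  have j_less: "j x < M" for x
  proof -
    have "j x \<le> card {..<M - 1}" unfolding j_def by (intro card_mono) auto
    then show ?thesis using M by simp
  qed
  have "loc_const j"
  proof (rule loc_constI[of "n + M"])
    fix x y assume "bits (n + M) x = bits (n + M) y"
    then have "{i. i < M - 1 \<and> e x (n + i)} = {i. i < M - 1 \<and> e y (n + i)}"
      unfolding bits_eq_iff by auto
    then show "j x = j y" by (simp only: j_def)
  qed
  define p where "p x = (if s (j x) = r x then j x else SOME i. i < M \<and> s i = r x)" for x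
  have p: "p x < M" "s (p x) = r x" if "x \<in> K" for x
  proof -
    have "r x \<in> s ` {..<M}" using s that by blast
    then have "\<exists>i. i < M \<and> s i = r x" by force
    note someI_ex[OF this]
    then show "p x < M" "s (p x) = r x" using j_less by (auto simp: p_def)
  qed
  have "loc_const (\<lambda>x. (\<lambda>(v, i). if s i = v then i else SOME i. i < M \<and> s i = v) (r x, j x))"
    by (rule loc_const_comp[OF loc_const_Pair[OF r \<open>loc_const j\<close>]])
  then have "loc_const p" by (simp add: p_def[abs_def])
  moreover have "p ` K = {..<M}"
  proof (intro equalityI subsetI)
    fix i assume i: "i \<in> {..<M}"
    then obtain y where y: "y \<in> K" "s i = r y" using s by blast
    \<comment> \<open>A point in the fibre of \<open>y\<close> with exactly \<open>i\<close> of the counted bits equal to \<open>True\<close>.\<close>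
    obtain x where x: "x \<in> K" "e x = (\<lambda>l. if l < n then e y l else l < n + i)"
      by (rule ex_point)
    have "bits n x = bits n y" unfolding bits_eq_iff by (simp add: x(2))
    then have "r x = s i" using n[OF x(1) y(1)] y(2) by simp
    moreover have "j x = i"
    proof -
      have "{l. l < M - 1 \<and> e x (n + l)} = {..<i}" using i by (auto simp: x(2))
      then show ?thesis by (simp add: j_def)
    qed
    ultimately have "p x = i" by (simp add: p_def)
    with x(1) show "i \<in> p ` K" by blast
  qed (use p(1) in auto)
  ultimately show ?thesis using p(2) by (rule that)
qed

text \<open>
  Given a coding by \<open>\<int>/m\<close>, every piece can be split into the same number of smaller pieces, as many
  as divisibility requires, so finely that the new coding determines \<open>N\<close> bits. The pairs of an old
  index \<open>a\<close> and a word of length \<open>N\<close> that occur are listed by \<open>u\<close>; the new index \<open>a + m t\<close> is given to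
  the \<open>t\<close>-th pair if that has first component \<open>a\<close>, and to some fixed pair over \<open>a\<close> otherwise.
\<close>

lemma ex_refined_coding:
  fixes p :: "'a \<Rightarrow> nat"
  assumes p: "loc_const p" "p ` K = {..<m}"
  obtains m' p' where "loc_const p'" "p' ` K = {..<m'}" "m dvd m'" "fact N dvd m'"
    "\<And>x. x \<in> K \<Longrightarrow> p' x mod m = p x"
    "\<And>x y. x \<in> K \<Longrightarrow> y \<in> K \<Longrightarrow> p' x = p' y \<Longrightarrow> bits N x = bits N y"
proof -
  define r where "r x = (p x, bits N x)" for x
  have r: "loc_const r"
    unfolding r_def[abs_def] by (rule loc_const_Pair[OF p(1) loc_const_bits])
  obtain u :: "nat \<Rightarrow> nat \<times> bool list" and c where u: "r ` K = u ` {i. i < c}"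
    using finite_imp_nat_seg_image_inj_on[OF loc_const_finite[OF r]] by blast
  have m: "m > 0" using p(2) K_nonempty by (cases m) auto
  define m' where "m' = m * (c * fact N)"
  have above: "\<exists>v. v \<in> r ` K \<and> fst v = i mod m" for i
  proof -
    have "i mod m \<in> p ` K" using m by (simp add: p(2))
    then show ?thesis by (auto simp: r_def)
  qed
  define s where "s i = (if i div m < c \<and> fst (u (i div m)) = i mod m then u (i div m)
      else SOME v. v \<in> r ` K \<and> fst v = i mod m)" for i
  have s: "s i \<in> r ` K" "fst (s i) = i mod m" for i
    using someI_ex[OF above[of i]] u by (auto simp: s_def)
  have "s ` {..<m'} = r ` K"
  proof (intro equalityI subsetI)
    fix v assume v: "v \<in> r ` K"
    then obtain t where t: "t < c" "v = u t" using u by auto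
    have "fst v \<in> p ` K" using v by (auto simp: r_def)
    then have a: "fst v < m" by (simp add: p(2))
    have "fst v + m * t < m * Suc t" using a by simp
    also have "\<dots> \<le> m * (c * fact N)"
    proof (rule mult_le_mono2)
      have "Suc t * 1 \<le> c * fact N" using t(1) by (intro mult_le_mono) (auto simp: Suc_le_eq)
      then show "Suc t \<le> c * fact N" by simp
    qed
    finally have "fst v + m * t < m'" by (simp only: m'_def)
    moreover have "s (fst v + m * t) = v" using a t by (simp add: s_def)
    ultimately show "v \<in> s ` {..<m'}" by (metis imageI lessThan_iff)
  qed (use s(1) in auto)
  then obtain p' where p': "loc_const p'" "p' ` K = {..<m'}" "\<And>x. x \<in> K \<Longrightarrow> s (p' x) = r x"
    using ex_coding[OF r] by blast
  show ?thesis
  proof (rule that[OF p'(1,2)])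
    show "m dvd m'" "fact N dvd m'" by (simp_all add: m'_def)
    show "p' x mod m = p x" if "x \<in> K" for x
      using s(2)[of "p' x"] p'(3)[OF that] by (simp add: r_def)
    show "bits N x = bits N y" if "x \<in> K" "y \<in> K" "p' x = p' y" for x y
      using p'(3)[OF that(1)] p'(3)[OF that(2)] that(3) by (simp add: r_def)
  qed
qed

section \<open>Odometers\<close>

text \<open>
  Compatible continuous coordinates modulo all \<open>k!\<close> define a map into the odometer. It is injective if
  they separate points, and surjective by compactness if each coordinate is onto: the fibres over the
  coordinates of a given point are nested, closed and nonempty.
\<close>

lemma homeomorphic_to_odometer:
  fixes g :: "nat \<Rightarrow> 'a \<Rightarrow> nat"
  assumes lc: "\<And>k. loc_const (g k)"
    and less: "\<And>k x. x \<in> K \<Longrightarrow> g k x < fact k"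
    and coh: "\<And>k x. x \<in> K \<Longrightarrow> g (Suc k) x mod fact k = g k x"
    and onto: "\<And>k a. a < fact k \<Longrightarrow> \<exists>x\<in>K. g k x = a"
    and sep: "\<And>x y. x \<in> K \<Longrightarrow> y \<in> K \<Longrightarrow> (\<And>k. k \<ge> 1 \<Longrightarrow> g k x = g k y) \<Longrightarrow> x = y"
  shows "homeomorphic_map mtopology universal_odometer_space (\<lambda>x. \<lambda>k\<in>{1..}. g k x)"
    (is "homeomorphic_map _ ?O ?h")
proof (rule continuous_imp_homeomorphic_map)
  let ?P = "product_topology (\<lambda>k. discrete_topology {..<fact k :: nat}) {1::nat..}"
  have mem: "?h x \<in> topspace ?O" if "x \<in> K" for x
    using less[OF that] coh[OF that]
    by (auto simp: topspace_universal_odometer_space simp del: fact_Suc)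
  have "continuous_map mtopology (discrete_topology {..<fact k}) (g k)" for k
  proof -
    have "continuous_map mtopology (subtopology (discrete_topology UNIV) {..<fact k}) (g k)"
      using lc[of k] less by (intro continuous_map_into_subtopology) (auto simp: loc_const_iff)
    then show ?thesis by simp
  qed
  then have "continuous_map mtopology ?P ?h"
    by (auto simp: continuous_map_componentwise)
  then show "continuous_map mtopology ?O ?h"
    using mem unfolding universal_odometer_space_def topspace_subtopology
    by (intro continuous_map_into_subtopology) auto
  show "compact_space mtopology" by (rule compact)
  show "Hausdorff_space ?O"
    using tds_universal_odometer metrizable_imp_Hausdorff_space by (auto simp: tds_def)
  show "inj_on ?h (topspace mtopology)"
  proof (rule inj_onI)
    fix x y assume xy: "x \<in> topspace mtopology" "y \<in> topspace mtopology" and eq: "?h x = ?h y"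
    have "g k x = g k y" if "k \<ge> 1" for k using fun_cong[OF eq, of k] that by simp
    then show "x = y" using xy by (intro sep) auto
  qed
  show "?h ` topspace mtopology = topspace ?O"
  proof (intro equalityI subsetI)
    fix o' assume o: "o' \<in> topspace ?O"
    \<comment> \<open>Indices are shifted because the odometer has no coordinate \<open>0\<close>.\<close>
    define C where "C k = {x \<in> K. g (Suc k) x = o' (Suc k)}" for k
    have less_o: "o' k < fact k" and coh_o: "o' (Suc k) mod fact k = o' k" if "k \<ge> 1" for k
      using o that by (auto simp: topspace_universal_odometer_space simp del: fact_Suc)
    have "closedin mtopology (C k)" for k
      using closedin_continuous_map_preimage[of mtopology "discrete_topology UNIV" "g (Suc k)" "{o' (Suc k)}"]
        lc[of "Suc k"] by (simp add: loc_const_iff C_def)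
    moreover have "C k \<noteq> {}" for k
      using onto[OF less_o[of "Suc k"]] by (auto simp: C_def)
    moreover have "decseq C"
    proof (rule decseq_SucI)
      show "C (Suc k) \<subseteq> C k" for k
      proof
        fix x assume "x \<in> C (Suc k)"
        then have x: "x \<in> K" "g (Suc (Suc k)) x = o' (Suc (Suc k))" by (auto simp: C_def)
        have "g (Suc k) x = o' (Suc k)"
          using coh[OF x(1), of "Suc k"] coh_o[of "Suc k"] x(2) by (simp del: fact_Suc)
        with x(1) show "x \<in> C k" by (simp add: C_def)
      qed
    qed
    ultimately have "(\<Inter>k. C k) \<noteq> {}"
      by (intro compact_space_imp_nest[OF compact])
    then obtain x where x: "\<And>k. x \<in> C k" by blast
    have "?h x = o'"
    proof (rule extensionalityI[where A = "{1..}"])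
      show "o' \<in> extensional {1..}"
        using o by (auto simp: topspace_universal_odometer_space PiE_def)
      fix k :: nat assume "k \<in> {1..}"
      then obtain l where "k = Suc l" by (cases k) auto
      then show "?h x k = o' k" using x[of l] by (simp add: C_def)
    qed simp
    moreover have "x \<in> K" using x[of 0] by (simp add: C_def)
    ultimately show "o' \<in> ?h ` topspace mtopology" by auto
  qed (use mem in auto)
qed

text \<open>
  A factor map from \<open>f\<close> to the rotation of \<open>\<int>/m\<close> whose fibres lie in cylinders of length \<open>n\<close>.
\<close>

definition cyclic_coding :: "nat \<Rightarrow> ('a \<Rightarrow> 'a) \<Rightarrow> nat \<Rightarrow> ('a \<Rightarrow> nat) \<Rightarrow> bool" where
  "cyclic_coding n f m c \<longleftrightarrow> 0 < m \<and> fact n dvd m \<and> loc_const c \<and>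
     (\<forall>x\<in>K. c x < m \<and> c (f x) = (c x + 1) mod m) \<and>
     (\<forall>x\<in>K. \<forall>y\<in>K. c x = c y \<longrightarrow> bits n x = bits n y)"

definition adding_machines :: "('a \<Rightarrow> 'a) set" where
  "adding_machines = {f \<in> Homeos. \<forall>n. \<exists>m c. cyclic_coding n f m c}"

lemma cyclic_codingD:
  assumes "cyclic_coding n f m c"
  shows "0 < m" "fact n dvd m" "loc_const c" "\<And>x. x \<in> K \<Longrightarrow> c x < m"
    "\<And>x. x \<in> K \<Longrightarrow> c (f x) = (c x + 1) mod m"
    "\<And>x y. x \<in> K \<Longrightarrow> y \<in> K \<Longrightarrow> c x = c y \<Longrightarrow> bits n x = bits n y"
  using assms unfolding cyclic_coding_def by blast+

lemma cyclic_codingI: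
  assumes "0 < m" "fact n dvd m" "loc_const c" "\<And>x. x \<in> K \<Longrightarrow> c x < m"
    "\<And>x. x \<in> K \<Longrightarrow> c (f x) = (c x + 1) mod m"
    "\<And>x y. x \<in> K \<Longrightarrow> y \<in> K \<Longrightarrow> c x = c y \<Longrightarrow> bits n x = bits n y"
  shows "cyclic_coding n f m c"
  using assms unfolding cyclic_coding_def by blast

lemma cyclic_coding_funpow:
  assumes f: "f \<in> Homeos" and c: "cyclic_coding n f m c" and x: "x \<in> K"
  shows "c ((f ^^ i) x) = (c x + i) mod m"
proof (induction i)
  case 0
  show ?case using cyclic_codingD(4)[OF c x] by simp
next
  case (Suc i)
  then show ?case
    using cyclic_codingD(5)[OF c funpow_in_K[OF f x, of i]] by (simp add: mod_simps)
qed

text \<open>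
  Every orbit runs through all residues of each cyclic coding, and the points with a given residue lie in
  one cylinder, as small as desired.
\<close>

lemma adding_machine_orbits_dense:
  assumes f: "f \<in> adding_machines" and x: "x \<in> K"
  shows "dense_orbit f x"
  unfolding dense_orbit_def
proof (intro ballI allI)
  fix y n assume y: "y \<in> K"
  have fH: "f \<in> Homeos" and "\<exists>m c. cyclic_coding n f m c" using f by (auto simp: adding_machines_def)
  then obtain m c where c: "cyclic_coding n f m c" by blast
  have "c ((f ^^ (c y + (m - c x))) x) = c y"
    using cyclic_coding_funpow[OF fH c x] cyclic_codingD(4)[OF c x] cyclic_codingD(4)[OF c y] by simp
  then show "\<exists>i. bits n ((f ^^ i) x) = bits n y"
    using cyclic_codingD(6)[OF c funpow_in_K[OF fH x] y] by blast
qed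

lemma adding_machines_subset_Homeo_tr: "adding_machines \<subseteq> Homeo_tr K d"
proof
  fix f assume f: "f \<in> adding_machines"
  then have "f \<in> Homeos" by (simp add: adding_machines_def)
  moreover obtain x where "x \<in> K" using K_nonempty by blast
  ultimately show "f \<in> Homeo_tr K d"
    unfolding Homeo_tr_def using tds_transitive_iff adding_machine_orbits_dense[OF f] by blast
qed

text \<open>
  A cyclic coding \<open>c\<close> of \<open>f\<close> is one of each \<open>g\<close> with \<open>c (g x) = c (f x)\<close> for all \<open>x\<close>; this holds for all
  \<open>g\<close> near \<open>f\<close>, as \<open>c\<close> is locally constant.
\<close>

lemma gdelta_adding_machines: "gdelta_in (Homeo_topology K d) adding_machines"
proof -
  have "openin (Homeo_topology K d) {f \<in> Homeos. \<exists>m c. cyclic_coding n f m c}" for n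
    unfolding openin_Homeo
  proof (intro conjI ballI)
    fix f assume "f \<in> {f \<in> Homeos. \<exists>m c. cyclic_coding n f m c}"
    then obtain m c where f: "f \<in> Homeos" and c: "cyclic_coding n f m c" by blast
    obtain k where k: "\<And>x y. x \<in> K \<Longrightarrow> y \<in> K \<Longrightarrow> bits k x = bits k y \<Longrightarrow> c x = c y"
      using cyclic_codingD(3)[OF c] by (rule loc_constE) blast
    have "cyclic_coding n g m c" if g: "g \<in> Homeos" and near: "near k f g" for g
    proof -
      have "c (g x) = c (f x)" if x: "x \<in> K" for x
        using near x by (intro k[OF HomeoD(4)[OF g x] HomeoD(4)[OF f x]]) (simp add: near_def)
      then have "c (g x) = (c x + 1) mod m" if "x \<in> K" for x
        using that cyclic_codingD(5)[OF c that] by simp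
      note cg = this
      show ?thesis
        by (rule cyclic_codingI[OF cyclic_codingD(1-4)[OF c] cg cyclic_codingD(6)[OF c]])
    qed
    then show "\<exists>k. \<forall>g\<in>Homeos. near k f g \<longrightarrow> g \<in> {f \<in> Homeos. \<exists>m c. cyclic_coding n f m c}" by blast
  qed auto
  then have "gdelta_in (Homeo_topology K d) S" if "S \<in> range (\<lambda>n. {f \<in> Homeos. \<exists>m c. cyclic_coding n f m c})" for S
    using that open_imp_gdelta_in by blast
  then have "gdelta_in (Homeo_topology K d) (\<Inter>n. {f \<in> Homeos. \<exists>m c. cyclic_coding n f m c})"
    by (intro gdelta_in_Inter) auto
  moreover have "adding_machines = (\<Inter>n. {f \<in> Homeos. \<exists>m c. cyclic_coding n f m c})"
    by (auto simp: adding_machines_def)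
  ultimately show ?thesis by simp
qed

lemma cyclic_coding_rotate:
  assumes c: "cyclic_coding n f m c" and fK: "\<And>x. x \<in> K \<Longrightarrow> f x \<in> K"
  shows "cyclic_coding n f m (\<lambda>x. (c x + t) mod m)"
proof -
  \<comment> \<open>Rotating by \<open>(m - 1) t\<close> undoes the rotation by \<open>t\<close>.\<close>
  have unshift: "((a + t) mod m + (m - 1) * t) mod m = a" if "a < m" for a
  proof -
    have "t + (m - 1) * t = m * t" using cyclic_codingD(1)[OF c] by (cases m) auto
    then have "a + t + (m - 1) * t = a + m * t" by simp
    then have "(a + t + (m - 1) * t) mod m = a" using that by (simp only: mod_mult_self2 mod_less)
    then show ?thesis by (simp only: mod_add_left_eq)
  qed
  have "c x = c y" if "x \<in> K" "y \<in> K" "(c x + t) mod m = (c y + t) mod m" for x y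
    using unshift[OF cyclic_codingD(4)[OF c that(1)]] unshift[OF cyclic_codingD(4)[OF c that(2)]] that(3) by simp
  moreover have "(c (f x) + t) mod m = ((c x + t) mod m + 1) mod m" if "x \<in> K" for x
    using cyclic_codingD(5)[OF c that] by (simp add: mod_simps add_ac)
  ultimately show ?thesis
    using cyclic_codingD(1)[OF c] cyclic_codingD(6)[OF c]
    by (intro cyclic_codingI cyclic_codingD(1,2)[OF c] loc_const_comp[OF cyclic_codingD(3)[OF c]]) (simp, blast, blast)
qed

text \<open>
  With codings normalised to be \<open>0\<close> at \<open>x0\<close>, the code of the \<open>i\<close>-th orbit point is \<open>i\<close> modulo the
  length of the cycle. By density of the orbit, any two codings at any point are the residues of one
  common time \<open>i\<close> (fact \<open>both\<close>), so they are compatible and their reductions modulo \<open>k!\<close> are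
  coordinates of the odometer. These reductions separate points: the \<open>n\<close>-th coding is a residue of the
  \<open>k\<close>-th coordinate as soon as its length \<open>m n\<close> divides \<open>k!\<close>, for instance if \<open>k = m n\<close>.
\<close>

lemma adding_machine_isomorphic_odometer:
  assumes f: "f \<in> adding_machines"
  shows "tds_isomorphic mtopology f universal_odometer_space universal_odometer_map"
proof -
  have fH: "f \<in> Homeos" using f by (simp add: adding_machines_def)
  obtain x0 where x0: "x0 \<in> K" using K_nonempty by blast
  have "\<exists>m c. cyclic_coding n f m c \<and> c x0 = 0" for n
  proof -
    obtain m c where c: "cyclic_coding n f m c" using f unfolding adding_machines_def by blast
    let ?c = "\<lambda>x. (c x + (m - c x0)) mod m"
    have "?c x0 = 0" using cyclic_codingD(4)[OF c x0] by simp
    moreover have "cyclic_coding n f m ?c" by (rule cyclic_coding_rotate[OF c HomeoD(4)[OF fH]])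
    ultimately show ?thesis by (intro exI[of _ m] exI[of _ ?c] conjI)
  qed
  then obtain m c where c: "\<And>n. cyclic_coding n f (m n) (c n)" and c0: "\<And>n. c n x0 = 0" by metis
  have orbit: "c n ((f ^^ i) x0) = i mod m n" for n i
    using cyclic_coding_funpow[OF fH c x0] by (simp add: c0)
  have both: "\<exists>i. c n x = i mod m n \<and> c k x = i mod m k" if x: "x \<in> K" for n k x
  proof -
    have "loc_const (\<lambda>x. (c n x, c k x))" by (intro loc_const_Pair cyclic_codingD(3)[OF c])
    then obtain l where l: "\<And>x y. x \<in> K \<Longrightarrow> y \<in> K \<Longrightarrow> bits l x = bits l y \<Longrightarrow>
        (c n x, c k x) = (c n y, c k y)"
      by (rule loc_constE) blast
    obtain i where "bits l ((f ^^ i) x0) = bits l x"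
      using adding_machine_orbits_dense[OF f x0] x unfolding dense_orbit_def by blast
    from l[OF funpow_in_K[OF fH x0] x this] have "c n x = i mod m n" "c k x = i mod m k"
      unfolding orbit by simp_all
    then show ?thesis by blast
  qed
  define g where "g k x = c k x mod fact k" for k x
  have dvd: "fact k dvd m k" for k using cyclic_codingD(2)[OF c] .
  have "homeomorphic_map mtopology universal_odometer_space (\<lambda>x. \<lambda>k\<in>{1..}. g k x)"
  proof (rule homeomorphic_to_odometer)
    show "loc_const (g k)" for k
      unfolding g_def[abs_def] by (rule loc_const_comp[OF cyclic_codingD(3)[OF c]])
    show "g k x < fact k" for k x by (simp add: g_def)
    show "g (Suc k) x mod fact k = g k x" if x: "x \<in> K" for k x
    proof -
      have dvd': "fact k dvd (fact (Suc k) :: nat)" by (simp add: fact_dvd)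
      obtain i where i: "c k x = i mod m k" "c (Suc k) x = i mod m (Suc k)"
        using both[OF x] by blast
      have "g (Suc k) x mod fact k = i mod fact k"
        unfolding g_def i using dvd' dvd[of "Suc k"]
        by (simp only: mod_mod_cancel[OF dvd'] mod_mod_cancel[OF dvd_trans[OF dvd' dvd]])
      also have "\<dots> = g k x" unfolding g_def i by (simp only: mod_mod_cancel[OF dvd])
      finally show ?thesis .
    qed
    show "\<exists>x\<in>K. g k x = a" if "a < fact k" for k a
    proof
      show "g k ((f ^^ a) x0) = a"
        unfolding g_def orbit mod_mod_cancel[OF dvd] using that by simp
    qed (rule funpow_in_K[OF fH x0])
    show "x = y" if x: "x \<in> K" and y: "y \<in> K" and eq: "\<And>k. k \<ge> 1 \<Longrightarrow> g k x = g k y" for x y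
    proof (rule bits_separate_points[OF x y])
      fix n
      let ?k = "m n"
      have pos: "?k \<ge> 1" using cyclic_codingD(1)[OF c[of n]] by simp
      have dv: "?k dvd fact ?k" using pos by (intro dvd_fact) auto
      obtain i where i: "c n x = i mod m n" "c ?k x = i mod m ?k" using both[OF x] by blast
      obtain j where j: "c n y = j mod m n" "c ?k y = j mod m ?k" using both[OF y] by blast
      have "i mod fact ?k = j mod fact ?k"
        using eq[OF pos] unfolding g_def i j by (simp only: mod_mod_cancel[OF dvd])
      then have "i mod fact ?k mod ?k = j mod fact ?k mod ?k" by simp
      then have "c n x = c n y" unfolding i j by (simp only: mod_mod_cancel[OF dv])
      then show "bits n x = bits n y" by (rule cyclic_codingD(6)[OF c x y])
    qed
  qed
  moreover have "(\<lambda>k\<in>{1..}. g k (f x)) = universal_odometer_map (\<lambda>k\<in>{1..}. g k x)"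
    if x: "x \<in> K" for x
  proof -
    have "g k (f x) = (g k x + 1) mod fact k" for k
    proof -
      have "g k (f x) = (c k x + 1) mod fact k"
        unfolding g_def cyclic_codingD(5)[OF c x] by (simp only: mod_mod_cancel[OF dvd])
      then show ?thesis by (simp only: g_def mod_add_left_eq)
    qed
    then show ?thesis
      unfolding universal_odometer_map_def by (intro restrict_ext) simp
  qed
  moreover have "tds mtopology f"
    unfolding tds_def using compact K_nonempty fH metrizable_space_mtopology by (auto simp: Homeo_def)
  ultimately show ?thesis
    unfolding tds_isomorphic_def using tds_universal_odometer by auto
qed

section \<open>Density of the odometers\<close>

text \<open>
  Iterated refinement yields compatible codings \<open>P n\<close> by \<open>\<int>/M n\<close> that separate points, starting from
  \<open>p\<close>. Since \<open>n!\<close> divides \<open>M n\<close> and \<open>M n\<close> divides \<open>k!\<close> for large \<open>k\<close>, they carry the same information as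
  coordinates modulo all \<open>k!\<close> and identify \<open>K\<close> with the universal odometer. The map \<open>+1\<close> pulled back to
  \<open>K\<close> is then \<open>+1\<close> on every \<open>P n\<close>.
\<close>

lemma ex_adding_machine_over_coding:
  fixes p :: "'a \<Rightarrow> nat"
  assumes p: "loc_const p" "p ` K = {..<m}"
  obtains f where "f \<in> adding_machines" "\<And>x. x \<in> K \<Longrightarrow> p (f x) = (p x + 1) mod m"
proof -
  define good where "good n s \<longleftrightarrow> (case s of (m, p) \<Rightarrow>
     loc_const p \<and> p ` K = {..<m} \<and> fact n dvd m \<and>
     (\<forall>x\<in>K. \<forall>y\<in>K. p x = p y \<longrightarrow> bits n x = bits n y))" for n and s :: "nat \<times> ('a \<Rightarrow> nat)"
  define step where "step s s' \<longleftrightarrow> (case (s, s') of ((m, p), (m', p')) \<Rightarrow>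
     m dvd m' \<and> (\<forall>x\<in>K. p' x mod m = p x))" for s s' :: "nat \<times> ('a \<Rightarrow> nat)"
  have ex: "\<exists>s'. good (Suc n) s' \<and> step s s'" if "good n s" for n s
  proof -
    obtain m p where s: "s = (m, p)" by (cases s)
    have "loc_const p" "p ` K = {..<m}"
      using \<open>good n s\<close> unfolding good_def s by simp_all
    then obtain m' p' where a: "loc_const p'" "p' ` K = {..<m'}" "m dvd m'" "fact (Suc n) dvd m'"
      and b: "\<And>x. x \<in> K \<Longrightarrow> p' x mod m = p x"
      and c: "\<And>x y. x \<in> K \<Longrightarrow> y \<in> K \<Longrightarrow> p' x = p' y \<Longrightarrow> bits (Suc n) x = bits (Suc n) y"
      by (rule ex_refined_coding[where N = "Suc n"]) blast
    have "good (Suc n) (m', p')"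
      unfolding good_def prod.case using a(1,2,4) c by blast
    moreover have "step s (m', p')"
      unfolding step_def s prod.case using a(3) b by blast
    ultimately show ?thesis by blast
  qed
  have "good 0 (m, p)" using p by (simp add: good_def bits_def)
  then obtain S where S: "S 0 = (m, p)" "\<And>n. good n (S n)" "\<And>n. step (S n) (S (Suc n))"
    using dependent_nat_choice[of "\<lambda>n s. good n s \<and> (n = 0 \<longrightarrow> s = (m, p))" "\<lambda>_. step"] ex
    by (metis old.nat.distinct(1))
  define M where "M n = fst (S n)" for n
  define P where "P n = snd (S n)" for n
  have M0: "M 0 = m" "P 0 = p" by (simp_all add: M_def P_def S(1))
  have P: "loc_const (P n)" "P n ` K = {..<M n}" "fact n dvd M n"
      "\<And>x y. x \<in> K \<Longrightarrow> y \<in> K \<Longrightarrow> P n x = P n y \<Longrightarrow> bits n x = bits n y" for n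
  proof -
    have "good n (M n, P n)" using S(2)[of n] by (simp only: M_def P_def prod.collapse)
    note this[unfolded good_def prod.case]
    then show "loc_const (P n)" "P n ` K = {..<M n}" "fact n dvd M n"
      "\<And>x y. x \<in> K \<Longrightarrow> y \<in> K \<Longrightarrow> P n x = P n y \<Longrightarrow> bits n x = bits n y" by blast+
  qed
  have MP: "M n dvd M (Suc n)" "\<And>x. x \<in> K \<Longrightarrow> P (Suc n) x mod M n = P n x" for n
  proof -
    have "step (M n, P n) (M (Suc n), P (Suc n))"
      using S(3)[of n] by (simp only: M_def P_def prod.collapse)
    note this[unfolded step_def prod.case]
    then show "M n dvd M (Suc n)" "\<And>x. x \<in> K \<Longrightarrow> P (Suc n) x mod M n = P n x" by blast+
  qed
  have Mpos: "M n > 0" for n using P(2)[of n] K_nonempty by (cases "M n") auto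
  have Pless: "P n x < M n" if "x \<in> K" for n x using P(2)[of n] that by auto
  have tower: "M n dvd M k \<and> (\<forall>x\<in>K. P k x mod M n = P n x)" if "n \<le> k" for n k
    using that
  proof (induction k rule: dec_induct)
    case base
    then show ?case using Pless by simp
  next
    case (step k)
    have "P (Suc k) x mod M n = P n x" if "x \<in> K" for x
    proof -
      have "P (Suc k) x mod M n = (P (Suc k) x mod M k) mod M n"
        using step.IH by (simp only: mod_mod_cancel)
      then show ?thesis using step.IH MP(2)[OF that] that by simp
    qed
    then show ?case using step.IH MP(1)[of k] dvd_trans by blast
  qed
  define g where "g k x = P k x mod fact k" for k x
  have recover: "P n x = g (n + M n) x mod M n" if "x \<in> K" for n x
  proof -
    have "M n dvd fact (n + M n)" using Mpos[of n] by (intro dvd_fact) auto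
    then have "g (n + M n) x mod M n = P (n + M n) x mod M n"
      unfolding g_def by (simp only: mod_mod_cancel)
    then show ?thesis using tower[of n "n + M n"] that by simp
  qed
  let ?h = "\<lambda>x. \<lambda>k\<in>{1..}. g k x"
  have "homeomorphic_map mtopology universal_odometer_space ?h"
  proof (rule homeomorphic_to_odometer)
    show "loc_const (g k)" for k
      unfolding g_def[abs_def] by (rule loc_const_comp[OF P(1)])
    show "g k x < fact k" for k x by (simp add: g_def)
    show "g (Suc k) x mod fact k = g k x" if x: "x \<in> K" for k x
    proof -
      have dvd': "fact k dvd (fact (Suc k) :: nat)" by (simp add: fact_dvd)
      have "g (Suc k) x mod fact k = P (Suc k) x mod fact k"
        unfolding g_def by (simp only: mod_mod_cancel[OF dvd'])
      also have "\<dots> = P (Suc k) x mod M k mod fact k"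
        by (simp only: mod_mod_cancel[OF P(3)])
      also have "\<dots> = g k x" by (simp only: MP(2)[OF x] g_def)
      finally show ?thesis .
    qed
    show "\<exists>x\<in>K. g k x = a" if a: "a < fact k" for k a
    proof -
      have "fact k \<le> M k" using P(3)[of k] Mpos[of k] by (simp add: dvd_imp_le)
      then have "a \<in> P k ` K" using a P(2)[of k] by simp
      then show ?thesis using a unfolding g_def by (metis imageE mod_less)
    qed
    show "x = y" if x: "x \<in> K" and y: "y \<in> K" and eq: "\<And>k. k \<ge> 1 \<Longrightarrow> g k x = g k y" for x y
    proof (rule bits_separate_points[OF x y])
      fix n
      have "n + M n \<ge> 1" using Mpos[of n] by simp
      then have "P n x = P n y" using recover[OF x] recover[OF y] eq by metis
      then show "bits n x = bits n y" by (rule P(4)[OF x y])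
    qed
  qed
  then obtain h' where h: "homeomorphic_maps mtopology universal_odometer_space ?h h'"
    unfolding homeomorphic_map_maps by blast
  define f where "f = restrict (h' \<circ> (universal_odometer_map \<circ> ?h)) K"
  have odo: "homeomorphic_map universal_odometer_space universal_odometer_space universal_odometer_map"
    using tds_universal_odometer by (simp add: tds_def)
  have "homeomorphic_map mtopology mtopology (h' \<circ> (universal_odometer_map \<circ> ?h))"
    using h odo by (meson homeomorphic_map_compose homeomorphic_maps_map)
  then have "homeomorphic_map mtopology mtopology f"
    by (rule homeomorphic_map_eq) (simp add: f_def)
  then have fH: "f \<in> Homeos" by (simp add: Homeo_def f_def)
  have hf: "?h (f x) = universal_odometer_map (?h x)" if x: "x \<in> K" for x
  proof -
    have "?h x \<in> topspace universal_odometer_space"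
      using h x by (auto simp: homeomorphic_maps_def continuous_map_def)
    then have "universal_odometer_map (?h x) \<in> topspace universal_odometer_space"
      using homeomorphic_imp_surjective_map[OF odo] by blast
    then have "?h (h' (universal_odometer_map (?h x))) = universal_odometer_map (?h x)"
      using h by (simp add: homeomorphic_maps_def)
    moreover have "f x = h' (universal_odometer_map (?h x))" using x by (simp add: f_def)
    ultimately show ?thesis by (simp only:)
  qed
  have gf: "g k (f x) = (g k x + 1) mod fact k" if "x \<in> K" "k \<ge> 1" for k x
    using fun_cong[OF hf[OF that(1)], of k] that(2) by (simp add: universal_odometer_map_def)
  have Pf: "P n (f x) = (P n x + 1) mod M n" if x: "x \<in> K" for n x
  proof -
    let ?k = "n + M n"
    have k: "?k \<ge> 1" and dv: "M n dvd fact ?k" using Mpos[of n] by (auto intro: dvd_fact)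
    have "P n (f x) = (g ?k x + 1) mod fact ?k mod M n"
      using recover[OF HomeoD(4)[OF fH x]] gf[OF x k] by simp
    also have "\<dots> = (g ?k x mod M n + 1) mod M n"
      by (simp only: mod_mod_cancel[OF dv] mod_add_left_eq)
    also have "\<dots> = (P n x + 1) mod M n" by (simp only: recover[OF x, symmetric])
    finally show ?thesis .
  qed
  have "cyclic_coding n f (M n) (P n)" for n
    by (rule cyclic_codingI[OF Mpos P(3,1) Pless Pf P(4)])
  then have "f \<in> adding_machines" unfolding adding_machines_def using fH by blast
  moreover have "p (f x) = (p x + 1) mod m" if "x \<in> K" for x
    using Pf[OF that, of 0] by (simp only: M0)
  ultimately show ?thesis by (rule that)
qed

text \<open>
  The values of \<open>r\<close> along one return of the dense orbit form a cycle of length \<open>m\<close> that runs through all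
  values of \<open>r\<close>. A map \<open>g\<close> that shifts a coding of \<open>K\<close> by this cycle transports the pieces as \<open>f\<close> transports
  the orbit points. Hence \<open>x\<close> and the \<open>f\<close>-preimage of \<open>g x\<close> have the same value of \<open>q\<close> (fact \<open>key\<close>),
  which compares \<open>f\<close> with \<open>g\<close> via the second component of \<open>q\<close> and, after substituting the
  \<open>g\<close>-preimage of \<open>x\<close> for \<open>x\<close>, the inverses via the first.
\<close>

lemma ex_adding_machine_near:
  assumes f: "f \<in> Homeo_tr K d"
  shows "\<exists>g\<in>adding_machines. near n f g"
proof -
  have fH: "f \<in> Homeos" using f by (simp add: Homeo_tr_def)
  let ?f' = "inv_into K f"
  obtain x0 where x0: "x0 \<in> K" "dense_orbit f x0"
    using f tds_transitive_iff[OF fH] by (auto simp: Homeo_tr_def)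
  define q where "q x = (bits n x, bits n (f x))" for x
  define r where "r x = (q x, q (?f' x))" for x
  have q: "loc_const q"
    unfolding q_def[abs_def] by (intro loc_const_Pair loc_const_bits loc_const_compose HomeoD(2)[OF fH])
  then have r: "loc_const r"
    unfolding r_def[abs_def] by (intro loc_const_Pair loc_const_compose[OF _ HomeoD(3)[OF fH]])
  obtain l where l: "\<And>x y. x \<in> K \<Longrightarrow> y \<in> K \<Longrightarrow> bits l x = bits l y \<Longrightarrow> r x = r y"
    using r by (rule loc_constE) blast
  define s where "s i = r ((f ^^ i) x0)" for i
  have xi: "(f ^^ i) x0 \<in> K" for i by (rule funpow_in_K[OF fH x0(1)])
  have "\<exists>i. s i = v" if v: "v \<in> r ` K" for v
  proof -
    obtain y where y: "y \<in> K" "v = r y" using v by blast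
    obtain i where "bits l ((f ^^ i) x0) = bits l y"
      using x0(2) y(1) unfolding dense_orbit_def by blast
    then have "s i = v" unfolding s_def y(2) by (rule l[OF xi y(1)])
    then show ?thesis ..
  qed
  then obtain visit where visit: "\<And>v. v \<in> r ` K \<Longrightarrow> s (visit v) = v" by metis
  have "finite (visit ` r ` K)" using loc_const_finite[OF r] by simp
  then obtain B where B: "\<And>v. v \<in> r ` K \<Longrightarrow> visit v < B"
    unfolding finite_nat_set_iff_bounded by blast
  obtain m where m: "m \<ge> Suc B" "bits l ((f ^^ m) x0) = bits l x0"
    using dense_orbit_recurs[OF x0(2) x0(1)] by blast
  have sm: "s m = s 0" unfolding s_def using l[OF xi x0(1) m(2)] by simp
  have "s ` {..<m} = r ` K"
  proof (intro equalityI subsetI)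
    fix v assume v: "v \<in> r ` K"
    have "visit v < m" using B[OF v] m(1) by simp
    then show "v \<in> s ` {..<m}" using visit[OF v] by (metis imageI lessThan_iff)
  qed (use xi in \<open>auto simp: s_def\<close>)
  then obtain p where p: "loc_const p" "p ` K = {..<m}" "\<And>x. x \<in> K \<Longrightarrow> s (p x) = r x"
    using ex_coding[OF r] by blast
  obtain g where g: "g \<in> adding_machines" "\<And>x. x \<in> K \<Longrightarrow> p (g x) = (p x + 1) mod m"
    using ex_adding_machine_over_coding[OF p(1,2)] by blast
  have gH: "g \<in> Homeos" using g(1) by (simp add: adding_machines_def)
  have key: "q (?f' (g x)) = q x" if x: "x \<in> K" for x
  proof -
    have px: "p x < m" using p(2) x by auto
    have "r (g x) = s ((p x + 1) mod m)"
      using p(3)[OF HomeoD(4)[OF gH x]] g(2)[OF x] by simp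
    also have "\<dots> = s (p x + 1)"
      using sm px by (cases "p x + 1 = m") auto
    finally have "q (?f' (g x)) = q (?f' (f ((f ^^ p x) x0)))"
      by (simp add: r_def s_def)
    also have "\<dots> = q ((f ^^ p x) x0)" by (simp only: HomeoD(6)[OF fH xi])
    also have "\<dots> = fst (s (p x))" by (simp add: s_def r_def)
    also have "\<dots> = q x" by (simp add: p(3)[OF x] r_def)
    finally show ?thesis .
  qed
  have "near n f g"
    unfolding near_def
  proof (intro ballI conjI)
    fix x assume x: "x \<in> K"
    have "f (?f' (g x)) = g x" by (rule HomeoD(7)[OF fH HomeoD(4)[OF gH x]])
    then show "bits n (f x) = bits n (g x)" using key[OF x] by (simp add: q_def)
    have "g (inv_into K g x) = x" by (rule HomeoD(7)[OF gH x])
    then show "bits n (?f' x) = bits n (inv_into K g x)"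
      using key[OF HomeoD(5)[OF gH x]] by (simp add: q_def)
  qed
  with g(1) show ?thesis by blast
qed

lemma closure_of_adding_machines: "Homeo_tr_topology K d closure_of adding_machines = topspace (Homeo_tr_topology K d)"
proof -
  let ?X = "Homeo_tr_topology K d"
  have top: "topspace ?X = Homeo_tr K d"
    unfolding Homeo_tr_topology_def by (auto simp: topspace_Homeo Homeo_tr_def)
  have "f \<in> ?X closure_of adding_machines" if f: "f \<in> Homeo_tr K d" for f
    unfolding in_closure_of
  proof (intro conjI allI impI)
    show "f \<in> topspace ?X" using f by (simp add: top)
    fix T assume "f \<in> T \<and> openin ?X T"
    then obtain U where U: "openin (Homeo_topology K d) U" "T = U \<inter> Homeo_tr K d" "f \<in> U"
      unfolding Homeo_tr_topology_def openin_subtopology by blast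
    then obtain n where n: "\<forall>g\<in>Homeos. near n f g \<longrightarrow> g \<in> U"
      unfolding openin_Homeo by blast
    obtain g where g: "g \<in> adding_machines" "near n f g" using ex_adding_machine_near[OF f] by blast
    then have "g \<in> T"
      using n adding_machines_subset_Homeo_tr U(2) unfolding adding_machines_def by blast
    with g(1) show "\<exists>g. g \<in> adding_machines \<and> g \<in> T" by blast
  qed
  then show ?thesis
    using closure_of_subset_topspace[of ?X adding_machines] unfolding top by blast
qed

lemma generic_odometer:
  "generic_in (Homeo_tr_topology K d)
     {f \<in> Homeo_tr K d. tds_isomorphic mtopology f universal_odometer_space universal_odometer_map}"
  unfolding generic_in_def
proof (intro exI conjI)
  show "gdelta_in (Homeo_tr_topology K d) adding_machines"
    unfolding Homeo_tr_topology_def gdelta_in_subtopology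
    using gdelta_adding_machines adding_machines_subset_Homeo_tr by blast
  show "Homeo_tr_topology K d closure_of adding_machines = topspace (Homeo_tr_topology K d)"
    by (rule closure_of_adding_machines)
  show "adding_machines \<subseteq> {f \<in> Homeo_tr K d.
      tds_isomorphic mtopology f universal_odometer_space universal_odometer_map}"
    using adding_machines_subset_Homeo_tr adding_machine_isomorphic_odometer by blast
qed

end

theorem theorem1p1:
  fixes K :: "'a set" and d :: "'a \<Rightarrow> 'a \<Rightarrow> real"
  assumes "Cantor_metric K d"
  shows "Polish_space (Homeo_tr_topology K d) \<and>
    generic_in (Homeo_tr_topology K d)
      {\<phi> \<in> Homeo_tr K d.
        tds_isomorphic (Metric_space.mtopology K d) \<phi>
          universal_odometer_space universal_odometer_map}"
proof -
  obtain e where "Cantor_bits K d e"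
    using assms by (rule Cantor_metric_bits)
  then interpret Cantor_bits K d e .
  show ?thesis
    using Polish_Homeo_tr generic_odometer by blast
qed

end
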